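(* Let $\mathcal T=\mathcal F(\mathbb Z/4\mathbb Z)$ be the category of finitely generated free $\mathbb Z/4\mathbb Z$-modules with the identity functor as translation, equipped with the (unique, by a theorem of Muro) triangulated category structure for which the triangle $$\mathbb Z/4\mathbb Z\xrightarrow{2}\mathbb Z/4\mathbb Z\xrightarrow{2}\mathbb Z/4\mathbb Z\xrightarrow{2}\mathbb Z/4\mathbb Z$$ is distinguished. Then the singular extension $$0\to\Theta\to\mathsf{Triangles}_0(\mathcal T)\xrightarrow{\pi}\mathcal T^{[1]}\to0$$ is not a pushforward along $\theta:\Delta\to\Theta$; that is, its class $\vartheta\in\mathsf{HH}^2(\mathcal T^{[1]},\Theta)$ does not lie in the image of $\theta_*:\mathsf{HH}^2(\mathcal T^{[1]},\Delta)\to\mathsf{HH}^2(\mathcal T^{[1]},\Theta)$. Equivalently, there do not exist a singular extension $0\to\Delta\to\mathcal E\xrightarrow{p}\mathcal T^{[1]}\to0$ and an additive functor $T:\mathcal E\to\mathsf{Triangles}_0(\mathcal T)$ with $\pi T=p$ restricting to $\theta$ on the kernels of $p$ and $\pi$.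
   Context: A (Puppe) triangulated category is an additive category $\mathcal T$ with an autoequivalence $A\mapsto A[1]$ and a class of diagrams $X\to Y\to Z\to X[1]$ (distinguished triangles) such that: (TR1) the class is closed under isomorphism of such diagrams; (TR2) $X\xrightarrow{\mathrm{id}}X\to0\to X[1]$ is distinguished; (TR3) if $X\xrightarrow{f}Y\xrightarrow{g}Z\xrightarrow{h}X[1]$ is distinguished then so is $Y\xrightarrow{g}Z\xrightarrow{h}X[1]\xrightarrow{-f[1]}Y[1]$; (TR4) every $f:X\to Y$ is the first map of some distinguished triangle; (TR5) any commutative square between the first maps of two distinguished triangles extends to a morphism of triangles. $\mathcal T^{[1]}$ is the category of arrows: objects are morphisms $f:A\to B$ of $\mathcal T$, morphisms $f\to f'$ are pairs $(a:A\to A',b:B\to B')$ with $bf=f'a$. For each $f:A\to B$ fix a distinguished triangle $A\xrightarrow{f}B\xrightarrow{u_f}C_f\xrightarrow{v_f}A[1]$. $\mathsf{Triangles}_0(\mathcal T)$ has the same objects as $\mathcal T^{[1]}$; its morphisms $[f]\to[f']$ are triples $(a,b,c:C_f\to C_{f'})$ with $bf=f'a$, $cu_f=u_{f'}b$, $a[1]v_f=v_{f'}c$; $\pi(a,b,c)=(a,b)$. The kernel of $\pi$ is a square zero ideal, identified via $c\mapsto(0,0,c)$ with the bifunctor $\Theta$ on $\mathcal T^{[1]}$, $\Theta(f,f')=\{c:C_f\to C_{f'}\mid cu_f=0,\ v_{f'}c=0\}$. The Toda bifunctor is: for $f:A\to B$, $f':A'\to B'$, $\Delta(f,f')$ is the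 quotient of $\mathrm{Hom}_{\mathcal T}(A[1],B')$ by $\{f'g-h\circ f[1]\mid g:A[1]\to A',h:B[1]\to B'\}$. The natural transformation $\theta:\Delta\to\Theta$ is induced by $x\mapsto u_{f'}xv_f$. A singular extension $0\to D\xrightarrow{i}\mathbb A\xrightarrow{F}\mathbb B\to0$ of an additive category $\mathbb B$ by a bifunctor $D:\mathbb B^{\mathrm{op}}\times\mathbb B\to\mathsf{Ab}$ consists of an additive category $\mathbb A$, an additive functor $F:\mathbb A\to\mathbb B$ such that the ideal $\ker F$ of morphisms killed by $F$ is square zero and $\mathbb A/\ker F\to\mathbb B$ is an isomorphism of categories, and an isomorphism of bifunctors $i:D(F(-),F(-))\to\ker F$. Equivalence classes of singular extensions of (small) $\mathbb B$ by $D$ are classified by the second (Shukla/Hochschild, equivalently Baues–Wirsching) cohomology group $\mathsf{HH}^2(\mathbb B,D)$. *)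

theory Defs
  imports
    "HOL-Algebra.Module"
    "HOL-Algebra.Product_Groups"
    "HOL-Number_Theory.Residues"
    "HOL-Library.Infinite_Typeclass"
begin

section \<open>Additive categories and functors\<close>

text \<open>
  The Hom-groups are \<^locale>\<open>comm_group\<close>s of HOL-Algebra, hence written multiplicatively: the group
  operation of \<open>Mor C X Y\<close> is the addition of morphisms, its unit is the zero morphism, and its
  \<open>inv\<close> is the negative. Hom-sets of different pairs of objects need not be disjoint, so
  composition is indexed by objects: \<open>cmp C X Y Z g f\<close> is the composite of \<open>f : X \<rightarrow> Y\<close> and
  \<open>g : Y \<rightarrow> Z\<close>.
\<close>

record ('o, 'm) category =
  Ob :: "'o set"
  Mor :: "'o \<Rightarrow> 'o \<Rightarrow> 'm monoid"
  cmp :: "'o \<Rightarrow> 'o \<Rightarrow> 'o \<Rightarrow> 'm \<Rightarrow> 'm \<Rightarrow> 'm"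
  ide :: "'o \<Rightarrow> 'm"

abbreviation hom_set :: "('o, 'm) category \<Rightarrow> 'o \<Rightarrow> 'o \<Rightarrow> 'm set" where
  "hom_set C X Y \<equiv> carrier (Mor C X Y)"

abbreviation zero_mor :: "('o, 'm) category \<Rightarrow> 'o \<Rightarrow> 'o \<Rightarrow> 'm" where
  "zero_mor C X Y \<equiv> \<one>\<^bsub>Mor C X Y\<^esub>"

locale preadditive_category =
  fixes C :: "('o, 'm) category"
  assumes hom_comm_group: "\<lbrakk>X \<in> Ob C; Y \<in> Ob C\<rbrakk> \<Longrightarrow> comm_group (Mor C X Y)"
    and ide_closed: "X \<in> Ob C \<Longrightarrow> ide C X \<in> hom_set C X X"
    and cmp_closed: "\<lbrakk>X \<in> Ob C; Y \<in> Ob C; Z \<in> Ob C; f \<in> hom_set C X Y; g \<in> hom_set C Y Z\<rbrakk>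
      \<Longrightarrow> cmp C X Y Z g f \<in> hom_set C X Z"
    and cmp_ide_right: "\<lbrakk>X \<in> Ob C; Y \<in> Ob C; f \<in> hom_set C X Y\<rbrakk> \<Longrightarrow> cmp C X X Y f (ide C X) = f"
    and cmp_ide_left: "\<lbrakk>X \<in> Ob C; Y \<in> Ob C; f \<in> hom_set C X Y\<rbrakk> \<Longrightarrow> cmp C X Y Y (ide C Y) f = f"
    and cmp_assoc: "\<lbrakk>W \<in> Ob C; X \<in> Ob C; Y \<in> Ob C; Z \<in> Ob C;
        f \<in> hom_set C W X; g \<in> hom_set C X Y; h \<in> hom_set C Y Z\<rbrakk>
      \<Longrightarrow> cmp C W X Z (cmp C X Y Z h g) f = cmp C W Y Z h (cmp C W X Y g f)"
    and cmp_add_right: "\<lbrakk>X \<in> Ob C; Y \<in> Ob C; Z \<in> Ob C;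
        f \<in> hom_set C X Y; f' \<in> hom_set C X Y; g \<in> hom_set C Y Z\<rbrakk>
      \<Longrightarrow> cmp C X Y Z g (f \<otimes>\<^bsub>Mor C X Y\<^esub> f') = cmp C X Y Z g f \<otimes>\<^bsub>Mor C X Z\<^esub> cmp C X Y Z g f'"
    and cmp_add_left: "\<lbrakk>X \<in> Ob C; Y \<in> Ob C; Z \<in> Ob C;
        f \<in> hom_set C X Y; g \<in> hom_set C Y Z; g' \<in> hom_set C Y Z\<rbrakk>
      \<Longrightarrow> cmp C X Y Z (g \<otimes>\<^bsub>Mor C Y Z\<^esub> g') f = cmp C X Y Z g f \<otimes>\<^bsub>Mor C X Z\<^esub> cmp C X Y Z g' f"

definition zero_object :: "('o, 'm) category \<Rightarrow> 'o \<Rightarrow> bool" where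
  "zero_object C Z \<longleftrightarrow> Z \<in> Ob C \<and>
     (\<forall>X\<in>Ob C. hom_set C X Z = {zero_mor C X Z} \<and> hom_set C Z X = {zero_mor C Z X})"

definition biproduct ::
    "('o, 'm) category \<Rightarrow> 'o \<Rightarrow> 'o \<Rightarrow> 'o \<Rightarrow> 'm \<Rightarrow> 'm \<Rightarrow> 'm \<Rightarrow> 'm \<Rightarrow> bool" where
  "biproduct C X Y P i j p q \<longleftrightarrow> P \<in> Ob C \<and>
     i \<in> hom_set C X P \<and> j \<in> hom_set C Y P \<and> p \<in> hom_set C P X \<and> q \<in> hom_set C P Y \<and>
     cmp C X P X p i = ide C X \<and> cmp C Y P Y q j = ide C Y \<and>
     cmp C X P Y q i = zero_mor C X Y \<and> cmp C Y P X p j = zero_mor C Y X \<and>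
     cmp C P X P i p \<otimes>\<^bsub>Mor C P P\<^esub> cmp C P Y P j q = ide C P"

locale additive_category = preadditive_category +
  assumes ex_zero_object: "\<exists>Z. zero_object C Z"
    and ex_biproduct: "\<lbrakk>X \<in> Ob C; Y \<in> Ob C\<rbrakk> \<Longrightarrow> \<exists>P i j p q. biproduct C X Y P i j p q"

definition iso_mor :: "('o, 'm) category \<Rightarrow> 'o \<Rightarrow> 'o \<Rightarrow> 'm \<Rightarrow> bool" where
  "iso_mor C X Y f \<longleftrightarrow> f \<in> hom_set C X Y \<and>
     (\<exists>g\<in>hom_set C Y X. cmp C X Y X g f = ide C X \<and> cmp C Y X Y f g = ide C Y)"

record ('o, 'm, 'p, 'n) cfunctor =
  fob :: "'o \<Rightarrow> 'p"
  fmor :: "'o \<Rightarrow> 'o \<Rightarrow> 'm \<Rightarrow> 'n"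

locale additive_functor =
  A: preadditive_category A + B: preadditive_category B
  for A :: "('o, 'm) category" and B :: "('p, 'n) category"
    and F :: "('o, 'm, 'p, 'n) cfunctor" +
  assumes fob_closed: "X \<in> Ob A \<Longrightarrow> fob F X \<in> Ob B"
    and fmor_hom: "\<lbrakk>X \<in> Ob A; Y \<in> Ob A\<rbrakk> \<Longrightarrow> fmor F X Y \<in> hom (Mor A X Y) (Mor B (fob F X) (fob F Y))"
    and fmor_ide: "X \<in> Ob A \<Longrightarrow> fmor F X X (ide A X) = ide B (fob F X)"
    and fmor_cmp: "\<lbrakk>X \<in> Ob A; Y \<in> Ob A; Z \<in> Ob A; f \<in> hom_set A X Y; g \<in> hom_set A Y Z\<rbrakk>
      \<Longrightarrow> fmor F X Z (cmp A X Y Z g f)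
        = cmp B (fob F X) (fob F Y) (fob F Z) (fmor F Y Z g) (fmor F X Y f)"

definition id_functor :: "('o, 'm, 'o, 'm) cfunctor" where
  "id_functor = \<lparr>fob = (\<lambda>X. X), fmor = (\<lambda>X Y f. f)\<rparr>"

definition comp_functor ::
    "('p, 'n, 'q, 'k) cfunctor \<Rightarrow> ('o, 'm, 'p, 'n) cfunctor \<Rightarrow> ('o, 'm, 'q, 'k) cfunctor" where
  "comp_functor G F =
     \<lparr>fob = (\<lambda>X. fob G (fob F X)), fmor = (\<lambda>X Y f. fmor G (fob F X) (fob F Y) (fmor F X Y f))\<rparr>"

text \<open>Equality of functors on \<open>A\<close>, ignoring the values of the representing functions elsewhere.\<close>

definition functor_eq ::
    "('o, 'm) category \<Rightarrow> ('o, 'm, 'p, 'n) cfunctor \<Rightarrow> ('o, 'm, 'p, 'n) cfunctor \<Rightarrow> bool" where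
  "functor_eq A F G \<longleftrightarrow> (\<forall>X\<in>Ob A. fob F X = fob G X) \<and>
     (\<forall>X\<in>Ob A. \<forall>Y\<in>Ob A. \<forall>f\<in>hom_set A X Y. fmor F X Y f = fmor G X Y f)"

definition nat_isomorphic :: "('o, 'm) category \<Rightarrow> ('p, 'n) category \<Rightarrow>
    ('o, 'm, 'p, 'n) cfunctor \<Rightarrow> ('o, 'm, 'p, 'n) cfunctor \<Rightarrow> bool" where
  "nat_isomorphic A B F G \<longleftrightarrow> (\<exists>\<eta>.
     (\<forall>X\<in>Ob A. iso_mor B (fob F X) (fob G X) (\<eta> X)) \<and>
     (\<forall>X\<in>Ob A. \<forall>Y\<in>Ob A. \<forall>f\<in>hom_set A X Y.
        cmp B (fob F X) (fob F Y) (fob G Y) (\<eta> Y) (fmor F X Y f)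
        = cmp B (fob F X) (fob G X) (fob G Y) (fmor G X Y f) (\<eta> X)))"

definition autoequivalence :: "('o, 'm) category \<Rightarrow> ('o, 'm, 'o, 'm) cfunctor \<Rightarrow> bool" where
  "autoequivalence C S \<longleftrightarrow> additive_functor C C S \<and>
     (\<exists>G. additive_functor C C G \<and> nat_isomorphic C C (comp_functor G S) id_functor \<and>
          nat_isomorphic C C (comp_functor S G) id_functor)"


section \<open>Puppe triangulated categories\<close>

text \<open>\<open>(X, Y, Z, f, g, h)\<close> encodes the diagram \<open>X \<rightarrow>f Y \<rightarrow>g Z \<rightarrow>h X[1]\<close>.\<close>

type_synonym ('o, 'm) triangle = "'o \<times> 'o \<times> 'o \<times> 'm \<times> 'm \<times> 'm"

definition candidate_triangles ::
    "('o, 'm) category \<Rightarrow> ('o, 'm, 'o, 'm) cfunctor \<Rightarrow> ('o, 'm) triangle set" where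
  "candidate_triangles C S = {(X, Y, Z, f, g, h). X \<in> Ob C \<and> Y \<in> Ob C \<and> Z \<in> Ob C \<and>
     f \<in> hom_set C X Y \<and> g \<in> hom_set C Y Z \<and> h \<in> hom_set C Z (fob S X)}"

definition triangle_mor :: "('o, 'm) category \<Rightarrow> ('o, 'm, 'o, 'm) cfunctor \<Rightarrow>
    ('o, 'm) triangle \<Rightarrow> ('o, 'm) triangle \<Rightarrow> 'm \<Rightarrow> 'm \<Rightarrow> 'm \<Rightarrow> bool" where
  "triangle_mor C S t t' a b c = (case (t, t') of ((X, Y, Z, f, g, h), (X', Y', Z', f', g', h')) \<Rightarrow>
     a \<in> hom_set C X X' \<and> b \<in> hom_set C Y Y' \<and> c \<in> hom_set C Z Z' \<and>
     cmp C X Y Y' b f = cmp C X X' Y' f' a \<and>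
     cmp C Y Z Z' c g = cmp C Y Y' Z' g' b \<and>
     cmp C Z (fob S X) (fob S X') (fmor S X X' a) h = cmp C Z Z' (fob S X') h' c)"

locale triangulated_category = additive_category C
  for C :: "('o, 'm) category" and S :: "('o, 'm, 'o, 'm) cfunctor"
    and \<D> :: "('o, 'm) triangle set" +
  assumes translation: "autoequivalence C S"
    and distinguished_candidate: "\<D> \<subseteq> candidate_triangles C S"
    and TR1: "\<lbrakk>(X, Y, Z, f, g, h) \<in> \<D>; (X', Y', Z', f', g', h') \<in> candidate_triangles C S;
        triangle_mor C S (X, Y, Z, f, g, h) (X', Y', Z', f', g', h') a b c;
        iso_mor C X X' a; iso_mor C Y Y' b; iso_mor C Z Z' c\<rbrakk>
      \<Longrightarrow> (X', Y', Z', f', g', h') \<in> \<D>"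
    and TR2: "\<lbrakk>X \<in> Ob C; zero_object C Z\<rbrakk>
      \<Longrightarrow> (X, X, Z, ide C X, zero_mor C X Z, zero_mor C Z (fob S X)) \<in> \<D>"
    and TR3: "(X, Y, Z, f, g, h) \<in> \<D>
      \<Longrightarrow> (Y, Z, fob S X, g, h, inv\<^bsub>Mor C (fob S X) (fob S Y)\<^esub> (fmor S X Y f)) \<in> \<D>"
    and TR4: "\<lbrakk>X \<in> Ob C; Y \<in> Ob C; f \<in> hom_set C X Y\<rbrakk> \<Longrightarrow> \<exists>Z g h. (X, Y, Z, f, g, h) \<in> \<D>"
    and TR5: "\<lbrakk>(X, Y, Z, f, g, h) \<in> \<D>; (X', Y', Z', f', g', h') \<in> \<D>;
        a \<in> hom_set C X X'; b \<in> hom_set C Y Y'; cmp C X Y Y' b f = cmp C X X' Y' f' a\<rbrakk>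
      \<Longrightarrow> \<exists>c. triangle_mor C S (X, Y, Z, f, g, h) (X', Y', Z', f', g', h') a b c"


section \<open>The category of arrows and the category of triangles\<close>

record ('o, 'm) arrow =
  src :: 'o
  tgt :: 'o
  arr :: 'm

definition arrow_category :: "('o, 'm) category \<Rightarrow> (('o, 'm) arrow, 'm \<times> 'm) category" where
  "arrow_category C =
     \<lparr>Ob = {X. src X \<in> Ob C \<and> tgt X \<in> Ob C \<and> arr X \<in> hom_set C (src X) (tgt X)},
      Mor = (\<lambda>X Y. (Mor C (src X) (src Y) \<times>\<times> Mor C (tgt X) (tgt Y))
        \<lparr>carrier := {(a, b). a \<in> hom_set C (src X) (src Y) \<and> b \<in> hom_set C (tgt X) (tgt Y) \<and>
           cmp C (src X) (tgt X) (tgt Y) b (arr X) = cmp C (src X) (src Y) (tgt Y) (arr Y) a}\<rparr>),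
      cmp = (\<lambda>X Y Z (a', b') (a, b).
        (cmp C (src X) (src Y) (src Z) a' a, cmp C (tgt X) (tgt Y) (tgt Z) b' b)),
      ide = (\<lambda>X. (ide C (src X), ide C (tgt X)))\<rparr>"

text \<open>A choice of \<open>f : A \<rightarrow> B \<rightarrow> C\<^sub>f \<rightarrow> A[1]\<close> for every arrow \<open>f\<close>.\<close>

record ('o, 'm) cones =
  cone :: "('o, 'm) arrow \<Rightarrow> 'o"
  cone_in :: "('o, 'm) arrow \<Rightarrow> 'm"
  cone_out :: "('o, 'm) arrow \<Rightarrow> 'm"

definition cone_choice ::
    "('o, 'm) category \<Rightarrow> ('o, 'm) triangle set \<Rightarrow> ('o, 'm) cones \<Rightarrow> bool" where
  "cone_choice C \<D> K \<longleftrightarrow>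
     (\<forall>X\<in>Ob (arrow_category C). (src X, tgt X, cone K X, arr X, cone_in K X, cone_out K X) \<in> \<D>)"

definition Triangles0 :: "('o, 'm) category \<Rightarrow> ('o, 'm, 'o, 'm) cfunctor \<Rightarrow> ('o, 'm) cones \<Rightarrow>
    (('o, 'm) arrow, 'm \<times> 'm \<times> 'm) category" where
  "Triangles0 C S K =
     \<lparr>Ob = Ob (arrow_category C),
      Mor = (\<lambda>X Y. (Mor C (src X) (src Y) \<times>\<times> (Mor C (tgt X) (tgt Y) \<times>\<times> Mor C (cone K X) (cone K Y)))
        \<lparr>carrier := {(a, b, c). (a, b) \<in> hom_set (arrow_category C) X Y \<and>
           c \<in> hom_set C (cone K X) (cone K Y) \<and>
           cmp C (tgt X) (cone K X) (cone K Y) c (cone_in K X)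
             = cmp C (tgt X) (tgt Y) (cone K Y) (cone_in K Y) b \<and>
           cmp C (cone K X) (fob S (src X)) (fob S (src Y)) (fmor S (src X) (src Y) a) (cone_out K X)
             = cmp C (cone K X) (cone K Y) (fob S (src Y)) (cone_out K Y) c}\<rparr>),
      cmp = (\<lambda>X Y Z (a', b', c') (a, b, c).
        (cmp C (src X) (src Y) (src Z) a' a, cmp C (tgt X) (tgt Y) (tgt Z) b' b,
         cmp C (cone K X) (cone K Y) (cone K Z) c' c)),
      ide = (\<lambda>X. (ide C (src X), ide C (tgt X), ide C (cone K X)))\<rparr>"

definition Triangles0_proj :: "(('o, 'm) arrow, 'm \<times> 'm \<times> 'm, ('o, 'm) arrow, 'm \<times> 'm) cfunctor" where
  "Triangles0_proj = \<lparr>fob = (\<lambda>X. X), fmor = (\<lambda>X Y (a, b, c). (a, b))\<rparr>"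


section \<open>Bifunctors with values in abelian groups\<close>

text \<open>
  \<open>bval D X Y\<close> is contravariant in \<open>X\<close> and covariant in \<open>Y\<close>: \<open>bpost D X Y Y' g\<close> is the map
  \<open>D X Y \<rightarrow> D X Y'\<close> induced by \<open>g : Y \<rightarrow> Y'\<close>, and \<open>bpre D X' X Y f\<close> is the map \<open>D X Y \<rightarrow> D X' Y\<close>
  induced by \<open>f : X' \<rightarrow> X\<close>.
\<close>

record ('o, 'm, 'd) bifun =
  bval :: "'o \<Rightarrow> 'o \<Rightarrow> 'd monoid"
  bpost :: "'o \<Rightarrow> 'o \<Rightarrow> 'o \<Rightarrow> 'm \<Rightarrow> 'd \<Rightarrow> 'd"
  bpre :: "'o \<Rightarrow> 'o \<Rightarrow> 'o \<Rightarrow> 'm \<Rightarrow> 'd \<Rightarrow> 'd"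

locale bifunctor =
  fixes B :: "('o, 'm) category" and D :: "('o, 'm, 'd) bifun"
  assumes bval_comm_group: "\<lbrakk>X \<in> Ob B; Y \<in> Ob B\<rbrakk> \<Longrightarrow> comm_group (bval D X Y)"
    and bpost_hom: "\<lbrakk>X \<in> Ob B; Y \<in> Ob B; Y' \<in> Ob B; g \<in> hom_set B Y Y'\<rbrakk>
      \<Longrightarrow> bpost D X Y Y' g \<in> hom (bval D X Y) (bval D X Y')"
    and bpre_hom: "\<lbrakk>X' \<in> Ob B; X \<in> Ob B; Y \<in> Ob B; f \<in> hom_set B X' X\<rbrakk>
      \<Longrightarrow> bpre D X' X Y f \<in> hom (bval D X Y) (bval D X' Y)"
    and bpost_ide: "\<lbrakk>X \<in> Ob B; Y \<in> Ob B; d \<in> carrier (bval D X Y)\<rbrakk> \<Longrightarrow> bpost D X Y Y (ide B Y) d = d"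
    and bpre_ide: "\<lbrakk>X \<in> Ob B; Y \<in> Ob B; d \<in> carrier (bval D X Y)\<rbrakk> \<Longrightarrow> bpre D X X Y (ide B X) d = d"
    and bpost_cmp: "\<lbrakk>X \<in> Ob B; Y \<in> Ob B; Y' \<in> Ob B; Y'' \<in> Ob B;
        g \<in> hom_set B Y Y'; g' \<in> hom_set B Y' Y''; d \<in> carrier (bval D X Y)\<rbrakk>
      \<Longrightarrow> bpost D X Y Y'' (cmp B Y Y' Y'' g' g) d = bpost D X Y' Y'' g' (bpost D X Y Y' g d)"
    and bpre_cmp: "\<lbrakk>X'' \<in> Ob B; X' \<in> Ob B; X \<in> Ob B; Y \<in> Ob B;
        f' \<in> hom_set B X'' X'; f \<in> hom_set B X' X; d \<in> carrier (bval D X Y)\<rbrakk>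
      \<Longrightarrow> bpre D X'' X Y (cmp B X'' X' X f f') d = bpre D X'' X' Y f' (bpre D X' X Y f d)"
    and bpost_bpre: "\<lbrakk>X' \<in> Ob B; X \<in> Ob B; Y \<in> Ob B; Y' \<in> Ob B;
        f \<in> hom_set B X' X; g \<in> hom_set B Y Y'; d \<in> carrier (bval D X Y)\<rbrakk>
      \<Longrightarrow> bpost D X' Y Y' g (bpre D X' X Y f d) = bpre D X' X Y' f (bpost D X Y Y' g d)"

text \<open>
  The bifunctor \<open>\<Theta>\<close>. Its values are the \<open>c\<close> with \<open>(0, 0, c)\<close> in the kernel of the projection from
  \<^const>\<open>Triangles0\<close>; a morphism \<open>(a, b)\<close> of arrows acts through composition with \<open>c'\<close> for any lift
  \<open>(a, b, c')\<close> of it. The result does not depend on the lift because the kernel is square zero.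
\<close>

definition Theta :: "('o, 'm) category \<Rightarrow> ('o, 'm, 'o, 'm) cfunctor \<Rightarrow> ('o, 'm) cones \<Rightarrow>
    (('o, 'm) arrow, 'm \<times> 'm, 'm) bifun" where
  "Theta C S K =
     \<lparr>bval = (\<lambda>X Y. (Mor C (cone K X) (cone K Y))
        \<lparr>carrier := {c \<in> hom_set C (cone K X) (cone K Y).
           cmp C (tgt X) (cone K X) (cone K Y) c (cone_in K X) = zero_mor C (tgt X) (cone K Y) \<and>
           cmp C (cone K X) (cone K Y) (fob S (src Y)) (cone_out K Y) c
             = zero_mor C (cone K X) (fob S (src Y))}\<rparr>),
      bpost = (\<lambda>X Y Y' (a, b) c. the_elem
        {cmp C (cone K X) (cone K Y) (cone K Y') c' c |c'. (a, b, c') \<in> hom_set (Triangles0 C S K) Y Y'}),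
      bpre = (\<lambda>X' X Y (a, b) c. the_elem
        {cmp C (cone K X') (cone K X) (cone K Y) c c' |c'. (a, b, c') \<in> hom_set (Triangles0 C S K) X' X})\<rparr>"

definition Theta_incl ::
    "('o, 'm) category \<Rightarrow> ('o, 'm) arrow \<Rightarrow> ('o, 'm) arrow \<Rightarrow> 'm \<Rightarrow> 'm \<times> 'm \<times> 'm" where
  "Theta_incl C X Y c = (zero_mor C (src X) (src Y), zero_mor C (tgt X) (tgt Y), c)"

text \<open>The Toda bifunctor \<open>\<Delta>\<close>; its elements are cosets in \<open>Hom(A[1], B')\<close>.\<close>

definition Toda_indeterminacy :: "('o, 'm) category \<Rightarrow> ('o, 'm, 'o, 'm) cfunctor \<Rightarrow>
    ('o, 'm) arrow \<Rightarrow> ('o, 'm) arrow \<Rightarrow> 'm set" where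
  "Toda_indeterminacy C S X Y =
     {cmp C (fob S (src X)) (src Y) (tgt Y) (arr Y) g \<otimes>\<^bsub>Mor C (fob S (src X)) (tgt Y)\<^esub>
      inv\<^bsub>Mor C (fob S (src X)) (tgt Y)\<^esub>
        (cmp C (fob S (src X)) (fob S (tgt X)) (tgt Y) h (fmor S (src X) (tgt X) (arr X))) |g h.
      g \<in> hom_set C (fob S (src X)) (src Y) \<and> h \<in> hom_set C (fob S (tgt X)) (tgt Y)}"

definition Toda :: "('o, 'm) category \<Rightarrow> ('o, 'm, 'o, 'm) cfunctor \<Rightarrow>
    (('o, 'm) arrow, 'm \<times> 'm, 'm set) bifun" where
  "Toda C S =
     \<lparr>bval = (\<lambda>X Y. Mor C (fob S (src X)) (tgt Y) Mod Toda_indeterminacy C S X Y),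
      bpost = (\<lambda>X Y Y' (a, b) \<xi>.
        Toda_indeterminacy C S X Y' <#>\<^bsub>Mor C (fob S (src X)) (tgt Y')\<^esub>
          (\<lambda>x. cmp C (fob S (src X)) (tgt Y) (tgt Y') b x) ` \<xi>),
      bpre = (\<lambda>X' X Y (a, b) \<xi>.
        Toda_indeterminacy C S X' Y <#>\<^bsub>Mor C (fob S (src X')) (tgt Y)\<^esub>
          (\<lambda>x. cmp C (fob S (src X')) (fob S (src X)) (tgt Y) x (fmor S (src X') (src X) a)) ` \<xi>)\<rparr>"

definition theta :: "('o, 'm) category \<Rightarrow> ('o, 'm, 'o, 'm) cfunctor \<Rightarrow> ('o, 'm) cones \<Rightarrow>
    ('o, 'm) arrow \<Rightarrow> ('o, 'm) arrow \<Rightarrow> 'm set \<Rightarrow> 'm" where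
  "theta C S K X Y \<xi> = the_elem
     ((\<lambda>x. cmp C (cone K X) (tgt Y) (cone K Y) (cone_in K Y)
             (cmp C (cone K X) (fob S (src X)) (tgt Y) x (cone_out K X))) ` \<xi>)"


section \<open>Singular extensions\<close>

definition functor_kernel :: "('o, 'm) category \<Rightarrow> ('p, 'n) category \<Rightarrow>
    ('o, 'm, 'p, 'n) cfunctor \<Rightarrow> 'o \<Rightarrow> 'o \<Rightarrow> 'm set" where
  "functor_kernel A B F X Y = kernel (Mor A X Y) (Mor B (fob F X) (fob F Y)) (fmor F X Y)"

text \<open>
  The assumptions \<open>quotient_ob\<close> and \<open>quotient_mor\<close> say that the functor \<open>A/ker F \<rightarrow> B\<close> induced by
  \<open>F\<close> is an isomorphism of categories.
\<close>

locale singular_extension =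
  bifunctor B D + A: additive_category A + B: additive_category B + F: additive_functor A B F
  for B :: "('p, 'n) category" and D :: "('p, 'n, 'd) bifun" and A :: "('o, 'm) category"
    and F :: "('o, 'm, 'p, 'n) cfunctor" and i :: "'o \<Rightarrow> 'o \<Rightarrow> 'd \<Rightarrow> 'm" +
  assumes square_zero: "\<lbrakk>X \<in> Ob A; Y \<in> Ob A; Z \<in> Ob A;
        f \<in> functor_kernel A B F X Y; g \<in> functor_kernel A B F Y Z\<rbrakk>
      \<Longrightarrow> cmp A X Y Z g f = zero_mor A X Z"
    and quotient_ob: "bij_betw (fob F) (Ob A) (Ob B)"
    and quotient_mor: "\<lbrakk>X \<in> Ob A; Y \<in> Ob A\<rbrakk> \<Longrightarrow> (\<lambda>\<xi>. the_elem (fmor F X Y ` \<xi>))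
        \<in> iso (Mor A X Y Mod functor_kernel A B F X Y) (Mor B (fob F X) (fob F Y))"
    and incl_iso: "\<lbrakk>X \<in> Ob A; Y \<in> Ob A\<rbrakk> \<Longrightarrow>
        i X Y \<in> iso (bval D (fob F X) (fob F Y)) ((Mor A X Y)\<lparr>carrier := functor_kernel A B F X Y\<rparr>)"
    and incl_post: "\<lbrakk>X \<in> Ob A; Y \<in> Ob A; Y' \<in> Ob A; g \<in> hom_set A Y Y';
        d \<in> carrier (bval D (fob F X) (fob F Y))\<rbrakk> \<Longrightarrow>
        i X Y' (bpost D (fob F X) (fob F Y) (fob F Y') (fmor F Y Y' g) d) = cmp A X Y Y' g (i X Y d)"
    and incl_pre: "\<lbrakk>X' \<in> Ob A; X \<in> Ob A; Y \<in> Ob A; f \<in> hom_set A X' X;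
        d \<in> carrier (bval D (fob F X) (fob F Y))\<rbrakk> \<Longrightarrow>
        i X' Y (bpre D (fob F X') (fob F X) (fob F Y) (fmor F X' X f) d) = cmp A X' X Y (i X Y d) f"

text \<open>
  A morphism from the extension \<open>(A, F, i)\<close> by \<open>D\<close> to the extension \<open>(A', F', i')\<close> that lies over
  the identity of the base and restricts to the natural transformation \<open>t\<close> on the kernels.
\<close>

definition extension_morphism :: "('p, 'n, 'd) bifun \<Rightarrow> ('p \<Rightarrow> 'p \<Rightarrow> 'd \<Rightarrow> 'd') \<Rightarrow>
    ('o, 'm) category \<Rightarrow> ('o, 'm, 'p, 'n) cfunctor \<Rightarrow> ('o \<Rightarrow> 'o \<Rightarrow> 'd \<Rightarrow> 'm) \<Rightarrow>
    ('o', 'm') category \<Rightarrow> ('o', 'm', 'p, 'n) cfunctor \<Rightarrow> ('o' \<Rightarrow> 'o' \<Rightarrow> 'd' \<Rightarrow> 'm') \<Rightarrow>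
    ('o, 'm, 'o', 'm') cfunctor \<Rightarrow> bool" where
  "extension_morphism D t A F i A' F' i' T \<longleftrightarrow>
     additive_functor A A' T \<and> functor_eq A (comp_functor F' T) F \<and>
     (\<forall>X\<in>Ob A. \<forall>Y\<in>Ob A. \<forall>d\<in>carrier (bval D (fob F X) (fob F Y)).
        fmor T X Y (i X Y d) = i' (fob T X) (fob T Y) (t (fob F X) (fob F Y) d))"


section \<open>Second cohomology and the class of an extension\<close>

text \<open>
  Baues-Wirsching cochains: an \<open>n\<close>-cochain assigns to each string of \<open>n\<close> composable morphisms an
  element of \<open>D\<close> at its source and target. Strings are written in order of composition, so
  \<open>(X, Y, Z, f, g)\<close> stands for \<open>f : X \<rightarrow> Y\<close> and \<open>g : Y \<rightarrow> Z\<close>.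
\<close>

definition strings1 :: "('o, 'm) category \<Rightarrow> ('o \<times> 'o \<times> 'm) set" where
  "strings1 B = {(X, Y, f). X \<in> Ob B \<and> Y \<in> Ob B \<and> f \<in> hom_set B X Y}"

definition strings2 :: "('o, 'm) category \<Rightarrow> ('o \<times> 'o \<times> 'o \<times> 'm \<times> 'm) set" where
  "strings2 B = {(X, Y, Z, f, g). X \<in> Ob B \<and> Y \<in> Ob B \<and> Z \<in> Ob B \<and>
     f \<in> hom_set B X Y \<and> g \<in> hom_set B Y Z}"

definition strings3 :: "('o, 'm) category \<Rightarrow> ('o \<times> 'o \<times> 'o \<times> 'o \<times> 'm \<times> 'm \<times> 'm) set" where
  "strings3 B = {(X, Y, Z, W, f, g, h). X \<in> Ob B \<and> Y \<in> Ob B \<and> Z \<in> Ob B \<and> W \<in> Ob B \<and>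
     f \<in> hom_set B X Y \<and> g \<in> hom_set B Y Z \<and> h \<in> hom_set B Z W}"

definition cochains1 ::
    "('o, 'm) category \<Rightarrow> ('o, 'm, 'd) bifun \<Rightarrow> ('o \<times> 'o \<times> 'm \<Rightarrow> 'd) monoid" where
  "cochains1 B D = product_group (strings1 B) (\<lambda>(X, Y, f). bval D X Y)"

definition cochains2 ::
    "('o, 'm) category \<Rightarrow> ('o, 'm, 'd) bifun \<Rightarrow> ('o \<times> 'o \<times> 'o \<times> 'm \<times> 'm \<Rightarrow> 'd) monoid" where
  "cochains2 B D = product_group (strings2 B) (\<lambda>(X, Y, Z, f, g). bval D X Z)"

definition cochains3 :: "('o, 'm) category \<Rightarrow> ('o, 'm, 'd) bifun \<Rightarrow>
    ('o \<times> 'o \<times> 'o \<times> 'o \<times> 'm \<times> 'm \<times> 'm \<Rightarrow> 'd) monoid" where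
  "cochains3 B D = product_group (strings3 B) (\<lambda>(X, Y, Z, W, f, g, h). bval D X W)"

text \<open>\<open>(d\<^sup>1 e)(g, f) = g e(f) - e(g f) + e(g) f\<close>\<close>

definition coboundary1 :: "('o, 'm) category \<Rightarrow> ('o, 'm, 'd) bifun \<Rightarrow>
    ('o \<times> 'o \<times> 'm \<Rightarrow> 'd) \<Rightarrow> ('o \<times> 'o \<times> 'o \<times> 'm \<times> 'm \<Rightarrow> 'd)" where
  "coboundary1 B D e = restrict (\<lambda>(X, Y, Z, f, g).
       bpost D X Y Z g (e (X, Y, f)) \<otimes>\<^bsub>bval D X Z\<^esub>
       inv\<^bsub>bval D X Z\<^esub> (e (X, Z, cmp B X Y Z g f)) \<otimes>\<^bsub>bval D X Z\<^esub>
       bpre D X Y Z f (e (Y, Z, g)))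
     (strings2 B)"

text \<open>\<open>(d\<^sup>2 c)(h, g, f) = h c(g, f) - c(h g, f) + c(h, g f) - c(h, g) f\<close>\<close>

definition coboundary2 :: "('o, 'm) category \<Rightarrow> ('o, 'm, 'd) bifun \<Rightarrow>
    ('o \<times> 'o \<times> 'o \<times> 'm \<times> 'm \<Rightarrow> 'd) \<Rightarrow> ('o \<times> 'o \<times> 'o \<times> 'o \<times> 'm \<times> 'm \<times> 'm \<Rightarrow> 'd)" where
  "coboundary2 B D c = restrict (\<lambda>(X, Y, Z, W, f, g, h).
       bpost D X Z W h (c (X, Y, Z, f, g)) \<otimes>\<^bsub>bval D X W\<^esub>
       inv\<^bsub>bval D X W\<^esub> (c (X, Y, W, f, cmp B Y Z W h g)) \<otimes>\<^bsub>bval D X W\<^esub>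
       c (X, Z, W, cmp B X Y Z g f, h) \<otimes>\<^bsub>bval D X W\<^esub>
       inv\<^bsub>bval D X W\<^esub> (bpre D X Y W f (c (Y, Z, W, g, h))))
     (strings3 B)"

definition cocycles2 ::
    "('o, 'm) category \<Rightarrow> ('o, 'm, 'd) bifun \<Rightarrow> ('o \<times> 'o \<times> 'o \<times> 'm \<times> 'm \<Rightarrow> 'd) set" where
  "cocycles2 B D = kernel (cochains2 B D) (cochains3 B D) (coboundary2 B D)"

definition coboundaries2 ::
    "('o, 'm) category \<Rightarrow> ('o, 'm, 'd) bifun \<Rightarrow> ('o \<times> 'o \<times> 'o \<times> 'm \<times> 'm \<Rightarrow> 'd) set" where
  "coboundaries2 B D = coboundary1 B D ` carrier (cochains1 B D)"

definition HH2 ::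
    "('o, 'm) category \<Rightarrow> ('o, 'm, 'd) bifun \<Rightarrow> ('o \<times> 'o \<times> 'o \<times> 'm \<times> 'm \<Rightarrow> 'd) set monoid" where
  "HH2 B D = (cochains2 B D)\<lparr>carrier := cocycles2 B D\<rparr> Mod coboundaries2 B D"

text \<open>The map on second cohomology induced by a natural transformation \<open>t\<close> into \<open>D'\<close>.\<close>

definition HH2_map :: "('o, 'm) category \<Rightarrow> ('o, 'm, 'e) bifun \<Rightarrow> ('o \<Rightarrow> 'o \<Rightarrow> 'd \<Rightarrow> 'e) \<Rightarrow>
    ('o \<times> 'o \<times> 'o \<times> 'm \<times> 'm \<Rightarrow> 'd) set \<Rightarrow> ('o \<times> 'o \<times> 'o \<times> 'm \<times> 'm \<Rightarrow> 'e) set" where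
  "HH2_map B D' t \<eta> = coboundaries2 B D' <#>\<^bsub>cochains2 B D'\<^esub>
     (\<lambda>c. restrict (\<lambda>(X, Y, Z, f, g). t X Z (c (X, Y, Z, f, g))) (strings2 B)) ` \<eta>"

text \<open>
  A section of \<open>F\<close> chooses, with no compatibility required, a preimage of every morphism of \<open>B\<close>.
  It determines the cocycle \<open>c(g, f) = s(g) s(f) - s(g f)\<close>, read as an element of \<open>D\<close> through \<open>i\<close>.
  Changing the section \<open>s\<close> to \<open>s + i e\<close> adds the coboundary of \<open>e\<close>, and every section arises in
  this way, so the cocycles of all sections form one coset of the coboundaries: the class of the
  extension in \<^const>\<open>HH2\<close>.
\<close>

definition sections :: "('p, 'n) category \<Rightarrow> ('o, 'm) category \<Rightarrow> ('o, 'm, 'p, 'n) cfunctor \<Rightarrow>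
    ('p \<times> 'p \<times> 'n \<Rightarrow> 'm) set" where
  "sections B A F = (let G = inv_into (Ob A) (fob F) in
     \<Pi>\<^sub>E (X, Y, f)\<in>strings1 B. {m \<in> hom_set A (G X) (G Y). fmor F (G X) (G Y) m = f})"

definition section_cocycle :: "('p, 'n) category \<Rightarrow> ('p, 'n, 'd) bifun \<Rightarrow> ('o, 'm) category \<Rightarrow>
    ('o, 'm, 'p, 'n) cfunctor \<Rightarrow> ('o \<Rightarrow> 'o \<Rightarrow> 'd \<Rightarrow> 'm) \<Rightarrow> ('p \<times> 'p \<times> 'n \<Rightarrow> 'm) \<Rightarrow>
    ('p \<times> 'p \<times> 'p \<times> 'n \<times> 'n \<Rightarrow> 'd)" where
  "section_cocycle B D A F i s = (let G = inv_into (Ob A) (fob F) in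
     restrict (\<lambda>(X, Y, Z, f, g). inv_into (carrier (bval D X Z)) (i (G X) (G Z))
         (cmp A (G X) (G Y) (G Z) (s (Y, Z, g)) (s (X, Y, f)) \<otimes>\<^bsub>Mor A (G X) (G Z)\<^esub>
          inv\<^bsub>Mor A (G X) (G Z)\<^esub> (s (X, Z, cmp B X Y Z g f))))
       (strings2 B))"

definition extension_class :: "('p, 'n) category \<Rightarrow> ('p, 'n, 'd) bifun \<Rightarrow> ('o, 'm) category \<Rightarrow>
    ('o, 'm, 'p, 'n) cfunctor \<Rightarrow> ('o \<Rightarrow> 'o \<Rightarrow> 'd \<Rightarrow> 'm) \<Rightarrow> ('p \<times> 'p \<times> 'p \<times> 'n \<times> 'n \<Rightarrow> 'd) set" where
  "extension_class B D A F i = section_cocycle B D A F i ` sections B A F"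


section \<open>Finitely generated free modules\<close>

definition free_of_rank :: "'a ring \<Rightarrow> ('a, 'v) module \<Rightarrow> nat \<Rightarrow> bool" where
  "free_of_rank R M n \<longleftrightarrow> module R M \<and>
     (\<exists>b\<in>{..<n} \<rightarrow> carrier M. \<forall>x\<in>carrier M. \<exists>!a. a \<in> {..<n} \<rightarrow>\<^sub>E carrier R \<and>
        x = (\<Oplus>\<^bsub>M\<^esub>j\<in>{..<n}. a j \<odot>\<^bsub>M\<^esub> b j))"

text \<open>
  The modules have their underlying sets in a type \<open>'v\<close>, which makes the category small; for
  infinite \<open>'v\<close> and finite \<open>R\<close> every finitely generated free module is isomorphic to one of these.
  Linear maps are extensional functions, so that equal maps are equal as HOL functions.
\<close>

definition linear_maps ::
    "'a ring \<Rightarrow> ('a, 'v) module \<Rightarrow> ('a, 'v) module \<Rightarrow> ('v \<Rightarrow> 'v) set" where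
  "linear_maps R M N = {f \<in> carrier M \<rightarrow>\<^sub>E carrier N.
     (\<forall>x\<in>carrier M. \<forall>y\<in>carrier M. f (x \<oplus>\<^bsub>M\<^esub> y) = f x \<oplus>\<^bsub>N\<^esub> f y) \<and>
     (\<forall>r\<in>carrier R. \<forall>x\<in>carrier M. f (r \<odot>\<^bsub>M\<^esub> x) = r \<odot>\<^bsub>N\<^esub> f x)}"

definition free_modules :: "'a ring \<Rightarrow> (('a, 'v) module, 'v \<Rightarrow> 'v) category" where
  "free_modules R =
     \<lparr>Ob = {M. \<exists>n. free_of_rank R M n},
      Mor = (\<lambda>M N. \<lparr>carrier = linear_maps R M N,
                    monoid.mult = (\<lambda>f g. \<lambda>x\<in>carrier M. f x \<oplus>\<^bsub>N\<^esub> g x),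
                    one = (\<lambda>x\<in>carrier M. \<zero>\<^bsub>N\<^esub>)\<rparr>),
      cmp = (\<lambda>M N P g f. compose (carrier M) g f),
      ide = (\<lambda>M. \<lambda>x\<in>carrier M. x)\<rparr>"

abbreviation F_Z4 :: "((int, 'v) module, 'v \<Rightarrow> 'v) category" where
  "F_Z4 \<equiv> free_modules (residue_ring 4)"

definition scalar_map :: "('a, 'v) module \<Rightarrow> 'a \<Rightarrow> 'v \<Rightarrow> 'v" where
  "scalar_map M r = (\<lambda>x\<in>carrier M. r \<odot>\<^bsub>M\<^esub> x)"

end

(*
  Let C be the cone of 2 : A \<rightarrow> A, and write X for the arrow 2. Comparing the given triangle with the
  chosen one shows that u : A \<rightarrow> C and v : C \<rightarrow> A are divisible by 2, so \<theta> vanishes on (X, X).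
  A realization of the class as a pushforward along \<theta> yields a choice of lifts \<sigma>(m) of the morphisms
  m of arrows whose failure to be multiplicative lies in the image of \<theta>. Hence
  \<sigma>(n) \<sigma>(m) = \<sigma>(n m) whenever n m is an endomorphism of X. This forces \<sigma> to be additive on the
  endomorphisms of X: since the kernel of \<pi> is square zero, \<sigma> preserves the identity and zero of X
  and carries the biproduct X \<oplus> X to a biproduct.
  Now (2, 2) = (2, 0) + (0, 2), where (2, 0) factors through A \<rightarrow> 0 and (0, 2) through 0 \<rightarrow> A. If
  \<phi> : A \<rightarrow> C and \<psi> : C \<rightarrow> A are the comparison maps, then \<psi> \<sigma>(m) \<phi> = 2 for m = (2, 0), (0, 2), and also
  \<psi> \<sigma>(2, 2) \<phi> = 2 \<psi> \<phi> = v \<phi> = 2. So 2 = 2 + 2 = 0 on A, a contradiction.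
*)
theory Submission
  imports Defs
begin

section \<open>Preadditive categories and cones\<close>

text \<open>The lift \<sigma> is only a function: neither additivity nor multiplicativity is given.
  The sole strictness available is for composites that start and end at X, where \<theta> vanishes.
  Composites that end at X \<oplus> X, such as \<sigma>(i) \<sigma>(p), are therefore not evaluated
  by \<sigma>. Their sum \<sigma>(i) \<sigma>(p) + \<sigma>(j) \<sigma>(q) is recognized as the
  identity by another route: it lifts the identity and is idempotent, and 1 is the only such
  endomorphism, because 1 - e would be an idempotent in a square zero ideal. The number 2 is treated
  as id + id, so the core argument takes place in an abstract triangulated category with identity
  translation and an object A with 4 = 0. The relation 2 2 = 0 enters three times: it makes \<theta>
  vanish on (X, X), it makes the squares of (2, 0) out of A \<rightarrow> 0 and of (0, 2) into 0
  \<rightarrow> A commute, and it turns 2 + 2 into 0 at the end. Both formulations of the result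
  reduce to one statement on set-theoretic sections of \<pi>. The class of an extension consists of
  the cocycles of all its sections, so a pushforward cocycle is exactly the cocycle of some section
  and no coboundary has to be carried along.\<close>

context preadditive_category
begin

lemma zero_mor_closed [simp]: "\<lbrakk>X \<in> Ob C; Y \<in> Ob C\<rbrakk> \<Longrightarrow> zero_mor C X Y \<in> hom_set C X Y"
  by (meson comm_group.axioms(2) group.is_monoid hom_comm_group monoid.one_closed)

lemma add_closed [simp]:
  "\<lbrakk>X \<in> Ob C; Y \<in> Ob C; f \<in> hom_set C X Y; g \<in> hom_set C X Y\<rbrakk>
    \<Longrightarrow> f \<otimes>\<^bsub>Mor C X Y\<^esub> g \<in> hom_set C X Y"
  by (meson comm_group.axioms(2) group.is_monoid hom_comm_group monoid.m_closed)

lemma neg_closed [simp]: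
  "\<lbrakk>X \<in> Ob C; Y \<in> Ob C; f \<in> hom_set C X Y\<rbrakk> \<Longrightarrow> inv\<^bsub>Mor C X Y\<^esub> f \<in> hom_set C X Y"
  by (meson comm_group.axioms(2) group.inv_closed hom_comm_group)

lemma hom_group: "\<lbrakk>X \<in> Ob C; Y \<in> Ob C\<rbrakk> \<Longrightarrow> group (Mor C X Y)"
  by (meson comm_group.axioms(2) hom_comm_group)

lemma add_zero [simp]:
  "\<lbrakk>X \<in> Ob C; Y \<in> Ob C; f \<in> hom_set C X Y\<rbrakk> \<Longrightarrow> f \<otimes>\<^bsub>Mor C X Y\<^esub> zero_mor C X Y = f"
  "\<lbrakk>X \<in> Ob C; Y \<in> Ob C; f \<in> hom_set C X Y\<rbrakk> \<Longrightarrow> zero_mor C X Y \<otimes>\<^bsub>Mor C X Y\<^esub> f = f"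
  by (simp_all add: hom_group group.is_monoid)

lemma neg_neg [simp]:
  "\<lbrakk>X \<in> Ob C; Y \<in> Ob C; f \<in> hom_set C X Y\<rbrakk> \<Longrightarrow> inv\<^bsub>Mor C X Y\<^esub> (inv\<^bsub>Mor C X Y\<^esub> f) = f"
  by (simp add: hom_group group.inv_inv)

lemma neg_zero [simp]:
  "\<lbrakk>X \<in> Ob C; Y \<in> Ob C\<rbrakk> \<Longrightarrow> inv\<^bsub>Mor C X Y\<^esub> zero_mor C X Y = zero_mor C X Y"
  by (simp add: hom_group group.is_monoid monoid.inv_one)

lemma neg_eq_iff:
  "\<lbrakk>X \<in> Ob C; Y \<in> Ob C; f \<in> hom_set C X Y; g \<in> hom_set C X Y\<rbrakk>
    \<Longrightarrow> inv\<^bsub>Mor C X Y\<^esub> f = inv\<^bsub>Mor C X Y\<^esub> g \<longleftrightarrow> f = g"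
  by (metis neg_neg)

lemma cmp_zero_right [simp]:
  assumes "X \<in> Ob C" "Y \<in> Ob C" "Z \<in> Ob C" "g \<in> hom_set C Y Z"
  shows "cmp C X Y Z g (zero_mor C X Y) = zero_mor C X Z"
proof -
  have "group_hom (Mor C X Y) (Mor C X Z) (cmp C X Y Z g)"
    using assms by (auto simp: group_hom_def group_hom_axioms_def hom_def hom_group cmp_closed cmp_add_right)
  then show ?thesis by (rule group_hom.hom_one)
qed

lemma cmp_zero_left [simp]:
  assumes "X \<in> Ob C" "Y \<in> Ob C" "Z \<in> Ob C" "f \<in> hom_set C X Y"
  shows "cmp C X Y Z (zero_mor C Y Z) f = zero_mor C X Z"
proof -
  have "group_hom (Mor C Y Z) (Mor C X Z) (\<lambda>g. cmp C X Y Z g f)"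
    using assms by (auto simp: group_hom_def group_hom_axioms_def hom_def hom_group cmp_closed cmp_add_left)
  then show ?thesis by (rule group_hom.hom_one)
qed

lemma cmp_neg_right:
  assumes "X \<in> Ob C" "Y \<in> Ob C" "Z \<in> Ob C" "f \<in> hom_set C X Y" "g \<in> hom_set C Y Z"
  shows "cmp C X Y Z g (inv\<^bsub>Mor C X Y\<^esub> f) = inv\<^bsub>Mor C X Z\<^esub> (cmp C X Y Z g f)"
proof -
  have "group_hom (Mor C X Y) (Mor C X Z) (cmp C X Y Z g)"
    using assms by (auto simp: group_hom_def group_hom_axioms_def hom_def hom_group cmp_closed cmp_add_right)
  then show ?thesis using assms by (simp add: group_hom.hom_inv)
qed

lemma cmp_neg_left:
  assumes "X \<in> Ob C" "Y \<in> Ob C" "Z \<in> Ob C" "f \<in> hom_set C X Y" "g \<in> hom_set C Y Z"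
  shows "cmp C X Y Z (inv\<^bsub>Mor C Y Z\<^esub> g) f = inv\<^bsub>Mor C X Z\<^esub> (cmp C X Y Z g f)"
proof -
  have "group_hom (Mor C Y Z) (Mor C X Z) (\<lambda>g. cmp C X Y Z g f)"
    using assms by (auto simp: group_hom_def group_hom_axioms_def hom_def hom_group cmp_closed cmp_add_left)
  then show ?thesis using assms group_hom.hom_inv by fastforce
qed

lemmas cat_simps = ide_closed cmp_closed cmp_ide_left cmp_ide_right cmp_neg_left cmp_neg_right

text \<open>Multiplication by 2 in terms of the additive structure alone; bilinearity makes it
  commute with every morphism.\<close>

definition double_ide :: "'o \<Rightarrow> 'm" where
  "double_ide X = ide C X \<otimes>\<^bsub>Mor C X X\<^esub> ide C X"

lemma double_ide_closed: "X \<in> Ob C \<Longrightarrow> double_ide X \<in> hom_set C X X"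
  by (simp add: double_ide_def ide_closed)

lemma cmp_double_ide_left:
  "\<lbrakk>X \<in> Ob C; Y \<in> Ob C; f \<in> hom_set C X Y\<rbrakk>
    \<Longrightarrow> cmp C X Y Y (double_ide Y) f = f \<otimes>\<^bsub>Mor C X Y\<^esub> f"
  by (simp add: double_ide_def cmp_add_left cat_simps)

lemma cmp_double_ide_right:
  "\<lbrakk>X \<in> Ob C; Y \<in> Ob C; f \<in> hom_set C X Y\<rbrakk>
    \<Longrightarrow> cmp C X X Y f (double_ide X) = f \<otimes>\<^bsub>Mor C X Y\<^esub> f"
  by (simp add: double_ide_def cmp_add_right cat_simps)

end

lemma id_functor_simps [simp]: "fob id_functor X = X" "fmor id_functor X Y f = f"
  by (simp_all add: id_functor_def)

section \<open>Exactness and cones in a triangulated category with identity translation\<close>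

locale untranslated_triangulated_category = triangulated_category C id_functor \<D>
  for C :: "('o, 'm) category" and \<D> :: "('o, 'm) triangle set"
begin

lemma triangleD:
  assumes "(X, Y, Z, f, g, h) \<in> \<D>"
  shows "X \<in> Ob C" "Y \<in> Ob C" "Z \<in> Ob C"
    "f \<in> hom_set C X Y" "g \<in> hom_set C Y Z" "h \<in> hom_set C Z X"
  using assms distinguished_candidate by (auto simp: candidate_triangles_def)

lemma rotate:
  "(X, Y, Z, f, g, h) \<in> \<D> \<Longrightarrow> (Y, Z, X, g, h, inv\<^bsub>Mor C X Y\<^esub> f) \<in> \<D>"
  using TR3[of X Y Z f g h] by simp

lemma fill:
  assumes "(X, Y, Z, f, g, h) \<in> \<D>" "(X', Y', Z', f', g', h') \<in> \<D>"
    "a \<in> hom_set C X X'" "b \<in> hom_set C Y Y'" "cmp C X Y Y' b f = cmp C X X' Y' f' a"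
  obtains c where "c \<in> hom_set C Z Z'" "cmp C Y Z Z' c g = cmp C Y Y' Z' g' b"
    "cmp C Z X X' a h = cmp C Z Z' X' h' c"
  using TR5[OF assms] by (auto simp: triangle_mor_def)

context
  fixes O'
  assumes zero: "zero_object C O'"
begin

lemma zero_Ob [simp]: "O' \<in> Ob C"
  using zero by (simp add: zero_object_def)

lemma into_zero: "\<lbrakk>X \<in> Ob C; f \<in> hom_set C X O'\<rbrakk> \<Longrightarrow> f = zero_mor C X O'"
  using zero by (auto simp: zero_object_def)

lemma from_zero: "\<lbrakk>X \<in> Ob C; f \<in> hom_set C O' X\<rbrakk> \<Longrightarrow> f = zero_mor C O' X"
  using zero by (auto simp: zero_object_def)

lemma ide_triangle: "X \<in> Ob C \<Longrightarrow> (X, X, O', ide C X, zero_mor C X O', zero_mor C O' X) \<in> \<D>"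
  using TR2[of X O'] zero by simp

text \<open>The two rotations of the identity triangle are the test triangles from which
  \<open>TR5\<close> yields exactness; the sign is that of \<open>TR3\<close>.\<close>

lemma ide_triangle_rot1:
  "X \<in> Ob C \<Longrightarrow> (X, O', X, zero_mor C X O', zero_mor C O' X, inv\<^bsub>Mor C X X\<^esub> ide C X) \<in> \<D>"
  using rotate[OF ide_triangle] .

lemma ide_triangle_rot2:
  "X \<in> Ob C \<Longrightarrow> (O', X, X, zero_mor C O' X, inv\<^bsub>Mor C X X\<^esub> ide C X, zero_mor C X O') \<in> \<D>"
  using rotate[OF ide_triangle_rot1] by simp

end

text \<open>The identity triangle on X maps to the given one by (id, f), so g f factors through the
  zero object.\<close>

lemma cmp12_zero:
  assumes "(X, Y, Z, f, g, h) \<in> \<D>"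
  shows "cmp C X Y Z g f = zero_mor C X Z"
proof -
  note [simp] = triangleD[OF assms] ide_closed
  obtain N where N: "zero_object C N" using ex_zero_object by blast
  note [simp] = zero_Ob[OF N]
  obtain c where "c \<in> hom_set C N Z" "cmp C X N Z c (zero_mor C X N) = cmp C X Y Z g f"
    by (rule fill[OF ide_triangle[OF N] assms, of X "ide C X" f]) (auto simp: cat_simps)
  then show ?thesis by simp
qed

lemma cmp31_zero:
  assumes "(X, Y, Z, f, g, h) \<in> \<D>"
  shows "cmp C Z X Y f h = zero_mor C Z Y"
proof -
  note [simp] = triangleD[OF assms]
  have "inv\<^bsub>Mor C Z Y\<^esub> (cmp C Z X Y f h) = zero_mor C Z Y"
    using cmp12_zero[OF rotate[OF rotate[OF assms]]] by (simp add: cat_simps)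
  then show ?thesis
    by (metis cmp_closed neg_neg neg_zero triangleD[OF assms])
qed

text \<open>A morphism of triangles from X' \<rightarrow> 0 \<rightarrow> X' with X' = W, starting
  with \<open>c\<close>, has the wanted factor as its third component.\<close>

lemma exact:
  assumes "(X, Y, Z, f, g, h) \<in> \<D>" "W \<in> Ob C" "c \<in> hom_set C W Z"
    "cmp C W Z X h c = zero_mor C W X"
  obtains z where "z \<in> hom_set C W Y" "c = cmp C W Y Z g z"
proof -
  note [simp] = triangleD[OF assms(1)] assms(2-4) ide_closed
  obtain N where N: "zero_object C N" using ex_zero_object by blast
  note [simp] = zero_Ob[OF N]
  \<comment> \<open>The target is rotated twice so that h comes first; its last map is then -g,
    whose sign cancels against the -id of the source.\<close>
  obtain z where z: "z \<in> hom_set C W Y"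
    "cmp C W W Z c (inv\<^bsub>Mor C W W\<^esub> ide C W) = cmp C W Y Z (inv\<^bsub>Mor C Y Z\<^esub> g) z"
    by (rule fill[OF ide_triangle_rot1[OF N] rotate[OF rotate[OF assms(1)]],
          of W c "zero_mor C N X"]) (auto)
  then have "inv\<^bsub>Mor C W Z\<^esub> c = inv\<^bsub>Mor C W Z\<^esub> (cmp C W Y Z g z)"
    by (simp add: cat_simps)
  then show thesis using z that by (simp add: neg_eq_iff cmp_closed)
qed

text \<open>Dual to \<open>exact\<close>: the triangle 0 \<rightarrow> W \<rightarrow> W is now the
  target, and the single remaining sign is absorbed into \<open>z\<close>.\<close>

lemma coexact:
  assumes "(X, Y, Z, f, g, h) \<in> \<D>" "W \<in> Ob C" "c \<in> hom_set C Z W"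
    "cmp C Y Z W c g = zero_mor C Y W"
  obtains z where "z \<in> hom_set C X W" "c = cmp C Z X W z h"
proof -
  note [simp] = triangleD[OF assms(1)] assms(2-4) ide_closed
  obtain N where N: "zero_object C N" using ex_zero_object by blast
  note [simp] = zero_Ob[OF N]
  obtain z where z: "z \<in> hom_set C X W"
    "cmp C Z X W z h = cmp C Z W W (inv\<^bsub>Mor C W W\<^esub> ide C W) c"
    by (rule fill[OF rotate[OF assms(1)] ide_triangle_rot2[OF N],
          of W "zero_mor C Y N" c]) auto
  then have "c = cmp C Z X W (inv\<^bsub>Mor C X W\<^esub> z) h"
    by (simp add: cat_simps)
  then show thesis using z by (intro that[of "inv\<^bsub>Mor C X W\<^esub> z"]) simp_all
qed

text \<open>Comparison with X \<rightarrow> 0 \<rightarrow> X over the identities gives a one-sided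
  inverse of h up to sign. With \<open>zero_second_mono\<close> it identifies the cone of X
  \<rightarrow> 0 with X[1] = X.\<close>

lemma zero_second_section:
  assumes "(X, N, Z, f, g, h) \<in> \<D>" "zero_object C N"
  obtains t where "t \<in> hom_set C X Z" "cmp C X Z X h t = ide C X"
proof -
  note [simp] = triangleD[OF assms(1)] ide_closed
  obtain c where "c \<in> hom_set C X Z"
    "cmp C X X X (ide C X) (inv\<^bsub>Mor C X X\<^esub> ide C X) = cmp C X Z X h c"
    by (rule fill[OF ide_triangle_rot1[OF assms(2)] assms(1), of X "ide C X" "ide C N"])
       (auto simp: cat_simps into_zero[OF assms(2), of X f])
  then show thesis by (intro that[of "inv\<^bsub>Mor C X Z\<^esub> c"]) (auto simp: cat_simps simp flip: \<open>_ = cmp C X Z X h c\<close>)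
qed

text \<open>By \<open>exact\<close> the difference of \<open>c\<close> and \<open>d\<close> factors
  through the zero object.\<close>

lemma zero_second_mono:
  assumes "(X, N, Z, f, g, h) \<in> \<D>" "zero_object C N" "W \<in> Ob C"
    "c \<in> hom_set C W Z" "d \<in> hom_set C W Z" "cmp C W Z X h c = cmp C W Z X h d"
  shows "c = d"
proof -
  note [simp] = triangleD[OF assms(1)] assms(3-5)
  interpret WX: comm_group "Mor C W X" by (simp add: hom_comm_group)
  interpret WZ: comm_group "Mor C W Z" by (simp add: hom_comm_group)
  have "cmp C W Z X h (c \<otimes>\<^bsub>Mor C W Z\<^esub> inv\<^bsub>Mor C W Z\<^esub> d) = zero_mor C W X"
    using assms(6) by (simp add: cmp_add_right cat_simps)
  then obtain z where "z \<in> hom_set C W N" "c \<otimes>\<^bsub>Mor C W Z\<^esub> inv\<^bsub>Mor C W Z\<^esub> d = cmp C W N Z g z"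
    using exact[OF assms(1), of W "c \<otimes>\<^bsub>Mor C W Z\<^esub> inv\<^bsub>Mor C W Z\<^esub> d"] by auto
  then have "c \<otimes>\<^bsub>Mor C W Z\<^esub> inv\<^bsub>Mor C W Z\<^esub> d = zero_mor C W Z"
    using into_zero[OF assms(2), of W z] by simp
  then show ?thesis by (metis WZ.inv_equality WZ.inv_inv WZ.inv_closed assms(4,5))
qed

text \<open>Dual of \<open>zero_second_section\<close>: together with \<open>zero_first_epi\<close>
  it identifies the cone of 0 \<rightarrow> Y with Y.\<close>

lemma zero_first_retraction:
  assumes "(N, Y, Z, f, g, h) \<in> \<D>" "zero_object C N"
  obtains r where "r \<in> hom_set C Z Y" "cmp C Y Z Y r g = ide C Y"
proof -
  note [simp] = triangleD[OF assms(1)] ide_closed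
  obtain c where "c \<in> hom_set C Z Y"
    "cmp C Y Z Y c g = cmp C Y Y Y (inv\<^bsub>Mor C Y Y\<^esub> ide C Y) (ide C Y)"
    by (rule fill[OF assms(1) ide_triangle_rot2[OF assms(2)], of Y "ide C N" "ide C Y"])
       (auto simp: cat_simps from_zero[OF assms(2), of Y f])
  then show thesis by (intro that[of "inv\<^bsub>Mor C Z Y\<^esub> c"]) (auto simp: cat_simps)
qed

lemma zero_first_epi:
  assumes "(N, Y, Z, f, g, h) \<in> \<D>" "zero_object C N" "W \<in> Ob C"
    "c \<in> hom_set C Z W" "d \<in> hom_set C Z W" "cmp C Y Z W c g = cmp C Y Z W d g"
  shows "c = d"
proof -
  note [simp] = triangleD[OF assms(1)] assms(3-5)
  interpret YW: comm_group "Mor C Y W" by (simp add: hom_comm_group)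
  interpret ZW: comm_group "Mor C Z W" by (simp add: hom_comm_group)
  have "cmp C Y Z W (c \<otimes>\<^bsub>Mor C Z W\<^esub> inv\<^bsub>Mor C Z W\<^esub> d) g = zero_mor C Y W"
    using assms(6) by (simp add: cmp_add_left cat_simps)
  then obtain z where "z \<in> hom_set C N W" "c \<otimes>\<^bsub>Mor C Z W\<^esub> inv\<^bsub>Mor C Z W\<^esub> d = cmp C Z N W z h"
    using coexact[OF assms(1), of W "c \<otimes>\<^bsub>Mor C Z W\<^esub> inv\<^bsub>Mor C Z W\<^esub> d"] by auto
  then have "c \<otimes>\<^bsub>Mor C Z W\<^esub> inv\<^bsub>Mor C Z W\<^esub> d = zero_mor C Z W"
    using from_zero[OF assms(2), of W z] by simp
  then show ?thesis by (metis ZW.inv_equality ZW.inv_inv ZW.inv_closed assms(4,5))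
qed

text \<open>Since h c = 0, \<open>c\<close> factors as g z, and d g = 0 kills it. For endomorphisms
  this is the square zero property of the kernel of \<pi>.\<close>

lemma cone_square_zero:
  assumes "(X, Y, Z, f, g, h) \<in> \<D>" "W \<in> Ob C" "W' \<in> Ob C" "c \<in> hom_set C W Z" "d \<in> hom_set C Z W'"
    "cmp C W Z X h c = zero_mor C W X" "cmp C Y Z W' d g = zero_mor C Y W'"
  shows "cmp C W Z W' d c = zero_mor C W W'"
proof -
  note [simp] = triangleD[OF assms(1)] assms(2-7)
  obtain z where [simp]: "z \<in> hom_set C W Y" and z: "c = cmp C W Y Z g z"
    using exact[OF assms(1,2,4,6)] .
  have "cmp C W Z W' d (cmp C W Y Z g z) = cmp C W Y W' (cmp C Y Z W' d g) z"
    by (simp add: cmp_assoc del: assms(7))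
  then show ?thesis by (simp add: z)
qed

text \<open>The complement n = 1 - e is again idempotent and satisfies n g = 0 and h n = 0, so n = n
  n = 0.\<close>

lemma cone_idempotent_eq_ide:
  assumes "(X, Y, Z, f, g, h) \<in> \<D>" "e \<in> hom_set C Z Z"
    "cmp C Y Z Z e g = g" "cmp C Z Z X h e = h" "cmp C Z Z Z e e = e"
  shows "e = ide C Z"
proof -
  note [simp] = triangleD[OF assms(1)] assms(2-5) ide_closed
  interpret YZ: comm_group "Mor C Y Z" by (simp add: hom_comm_group)
  interpret ZX: comm_group "Mor C Z X" by (simp add: hom_comm_group)
  interpret ZZ: comm_group "Mor C Z Z" by (simp add: hom_comm_group)
  define n where "n = ide C Z \<otimes>\<^bsub>Mor C Z Z\<^esub> inv\<^bsub>Mor C Z Z\<^esub> e"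
  have n [simp]: "n \<in> hom_set C Z Z" by (simp add: n_def)
  have "cmp C Z Z X h n = zero_mor C Z X" "cmp C Y Z Z n g = zero_mor C Y Z"
    by (simp_all add: n_def cmp_add_right cmp_add_left cat_simps)
  then have "cmp C Z Z Z n n = zero_mor C Z Z"
    using cone_square_zero[OF assms(1), of Z Z n n] by simp
  moreover have "cmp C Z Z Z n n = n"
    by (simp add: n_def cmp_add_right cmp_add_left cat_simps)
  ultimately have "ide C Z \<otimes>\<^bsub>Mor C Z Z\<^esub> inv\<^bsub>Mor C Z Z\<^esub> e = zero_mor C Z Z"
    by (simp add: n_def)
  then show ?thesis by (metis ZZ.inv_equality ZZ.inv_inv ZZ.inv_closed assms(2) ide_closed triangleD(3)[OF assms(1)])
qed

end

section \<open>Lifts that are multiplicative modulo theta\<close>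

lemma arrow_category_Ob [simp]:
  "X \<in> Ob (arrow_category C) \<longleftrightarrow>
     src X \<in> Ob C \<and> tgt X \<in> Ob C \<and> arr X \<in> hom_set C (src X) (tgt X)"
  by (simp add: arrow_category_def)

lemma arrow_category_hom [simp]:
  "(a, b) \<in> hom_set (arrow_category C) X Y \<longleftrightarrow>
     a \<in> hom_set C (src X) (src Y) \<and> b \<in> hom_set C (tgt X) (tgt Y) \<and>
     cmp C (src X) (tgt X) (tgt Y) b (arr X) = cmp C (src X) (src Y) (tgt Y) (arr Y) a"
  by (simp add: arrow_category_def)

lemma arrow_category_cmp [simp]:
  "cmp (arrow_category C) X Y Z (a', b') (a, b) =
     (cmp C (src X) (src Y) (src Z) a' a, cmp C (tgt X) (tgt Y) (tgt Z) b' b)"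
  by (simp add: arrow_category_def)

lemma Triangles0_Ob [simp]: "Ob (Triangles0 C S K) = Ob (arrow_category C)"
  by (simp add: Triangles0_def)

lemma Triangles0_hom [simp]:
  "(a, b, c) \<in> hom_set (Triangles0 C S K) X Y \<longleftrightarrow>
     (a, b) \<in> hom_set (arrow_category C) X Y \<and>
     c \<in> hom_set C (cone K X) (cone K Y) \<and>
     cmp C (tgt X) (cone K X) (cone K Y) c (cone_in K X)
       = cmp C (tgt X) (tgt Y) (cone K Y) (cone_in K Y) b \<and>
     cmp C (cone K X) (fob S (src X)) (fob S (src Y)) (fmor S (src X) (src Y) a) (cone_out K X)
       = cmp C (cone K X) (cone K Y) (fob S (src Y)) (cone_out K Y) c"
  by (simp add: Triangles0_def)

lemma Triangles0_cmp [simp]: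
  "cmp (Triangles0 C S K) X Y Z (a', b', c') (a, b, c) =
     (cmp C (src X) (src Y) (src Z) a' a, cmp C (tgt X) (tgt Y) (tgt Z) b' b,
      cmp C (cone K X) (cone K Y) (cone K Z) c' c)"
  by (simp add: Triangles0_def)

lemma strings1_iff [simp]: "(X, Y, f) \<in> strings1 B \<longleftrightarrow> X \<in> Ob B \<and> Y \<in> Ob B \<and> f \<in> hom_set B X Y"
  by (simp add: strings1_def)

lemma strings2_iff [simp]:
  "(X, Y, Z, f, g) \<in> strings2 B \<longleftrightarrow>
     X \<in> Ob B \<and> Y \<in> Ob B \<and> Z \<in> Ob B \<and> f \<in> hom_set B X Y \<and> g \<in> hom_set B Y Z"
  by (simp add: strings2_def)

lemma (in preadditive_category) square_cmp:
  assumes "X \<in> Ob C" "Y \<in> Ob C" "X' \<in> Ob C" "Y' \<in> Ob C" "X'' \<in> Ob C" "Y'' \<in> Ob C"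
    "f \<in> hom_set C X Y" "f' \<in> hom_set C X' Y'" "f'' \<in> hom_set C X'' Y''"
    "a \<in> hom_set C X X'" "a' \<in> hom_set C X' X''" "b \<in> hom_set C Y Y'" "b' \<in> hom_set C Y' Y''"
    and 1: "cmp C X Y Y' b f = cmp C X X' Y' f' a"
    and 2: "cmp C X' Y' Y'' b' f' = cmp C X' X'' Y'' f'' a'"
  shows "cmp C X Y Y'' (cmp C Y Y' Y'' b' b) f = cmp C X X'' Y'' f'' (cmp C X X' X'' a' a)"
proof -
  note [simp] = assms(1-13)
  have "cmp C X Y Y'' (cmp C Y Y' Y'' b' b) f = cmp C X Y' Y'' b' (cmp C X Y Y' b f)"
    by (simp add: cmp_assoc)
  also have "\<dots> = cmp C X X' Y'' (cmp C X' Y' Y'' b' f') a"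
    by (simp add: 1 cmp_assoc)
  also have "\<dots> = cmp C X X'' Y'' f'' (cmp C X X' X'' a' a)"
    by (simp add: 2 cmp_assoc)
  finally show ?thesis .
qed

lemma (in preadditive_category) arrow_category_cmp_closed:
  assumes "X \<in> Ob (arrow_category C)" "Y \<in> Ob (arrow_category C)" "Z \<in> Ob (arrow_category C)"
    "f \<in> hom_set (arrow_category C) X Y" "g \<in> hom_set (arrow_category C) Y Z"
  shows "cmp (arrow_category C) X Y Z g f \<in> hom_set (arrow_category C) X Z"
proof -
  obtain a b a' b' where fg: "f = (a, b)" "g = (a', b')" by (cases f; cases g) auto
  have "cmp C (src X) (tgt X) (tgt Z) (cmp C (tgt X) (tgt Y) (tgt Z) b' b) (arr X)
    = cmp C (src X) (src Z) (tgt Z) (arr Z) (cmp C (src X) (src Y) (src Z) a' a)"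
    by (rule square_cmp[of _ _ "src Y" "tgt Y" _ _ _ "arr Y"]) (use assms in \<open>auto simp: fg\<close>)
  then show ?thesis using assms by (simp add: fg cmp_closed)
qed

context untranslated_triangulated_category
begin

context
  fixes K :: "('o, 'm) cones"
  assumes cones: "cone_choice C \<D> K"
begin

lemma cone_triangle:
  "X \<in> Ob (arrow_category C) \<Longrightarrow> (src X, tgt X, cone K X, arr X, cone_in K X, cone_out K X) \<in> \<D>"
  using cones by (simp add: cone_choice_def)

lemmas cone_closed = triangleD[OF cone_triangle]

lemma Triangles0_cmp_closed:
  assumes "X \<in> Ob (arrow_category C)" "Y \<in> Ob (arrow_category C)" "Z \<in> Ob (arrow_category C)"
    "f \<in> hom_set (Triangles0 C id_functor K) X Y" "g \<in> hom_set (Triangles0 C id_functor K) Y Z"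
  shows "cmp (Triangles0 C id_functor K) X Y Z g f \<in> hom_set (Triangles0 C id_functor K) X Z"
proof -
  obtain a b c a' b' c' where fg: "f = (a, b, c)" "g = (a', b', c')" by (cases f; cases g) auto
  note [simp] = cone_closed[OF assms(1)] cone_closed[OF assms(2)] cone_closed[OF assms(3)]
  have "cmp C (cone K X) (src X) (src Z) (cmp C (src X) (src Y) (src Z) a' a) (cone_out K X)
    = cmp C (cone K X) (cone K Z) (src Z) (cone_out K Z) (cmp C (cone K X) (cone K Y) (cone K Z) c' c)"
    by (rule square_cmp[of _ _ "cone K Y" "src Y" _ _ _ "cone_out K Y"]) (use assms in \<open>auto simp: fg\<close>)
  moreover have "cmp C (tgt X) (cone K X) (cone K Z) (cmp C (cone K X) (cone K Y) (cone K Z) c' c) (cone_in K X)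
    = cmp C (tgt X) (tgt Z) (cone K Z) (cone_in K Z) (cmp C (tgt X) (tgt Y) (tgt Z) b' b)"
    by (rule square_cmp[of _ _ "tgt Y" "cone K Y" _ _ _ "cone_in K Y"]) (use assms in \<open>auto simp: fg\<close>)
  ultimately show ?thesis
    using assms arrow_category_cmp_closed[OF assms(1-3), of "(a, b)" "(a', b')"]
    by (simp add: fg cmp_closed)
qed

end

end

text \<open>
  \<open>\<sigma> X Y a b\<close> is the third component of a lift of \<open>(a, b)\<close>; no additivity is required of \<open>\<sigma>\<close>, as
  Baues-Wirsching cochains are arbitrary functions.
\<close>

locale lift_modulo_theta = untranslated_triangulated_category C \<D>
  for C :: "('o, 'm) category" and \<D> :: "('o, 'm) triangle set" +
  fixes K :: "('o, 'm) cones"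
    and \<sigma> :: "('o, 'm) arrow \<Rightarrow> ('o, 'm) arrow \<Rightarrow> 'm \<Rightarrow> 'm \<Rightarrow> 'm"
  assumes cones: "cone_choice C \<D> K"
    and lift: "\<lbrakk>X \<in> Ob (arrow_category C); Y \<in> Ob (arrow_category C);
      (a, b) \<in> hom_set (arrow_category C) X Y\<rbrakk>
        \<Longrightarrow> (a, b, \<sigma> X Y a b) \<in> hom_set (Triangles0 C id_functor K) X Y"
    and lift_cmp: "\<lbrakk>X \<in> Ob (arrow_category C); Y \<in> Ob (arrow_category C); Z \<in> Ob (arrow_category C);
      (a, b) \<in> hom_set (arrow_category C) X Y; (a', b') \<in> hom_set (arrow_category C) Y Z\<rbrakk>
        \<Longrightarrow> \<exists>x\<in>hom_set C (src X) (tgt Z).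
          cmp C (cone K X) (cone K Y) (cone K Z) (\<sigma> Y Z a' b') (\<sigma> X Y a b)
          = \<sigma> X Z (cmp C (src X) (src Y) (src Z) a' a) (cmp C (tgt X) (tgt Y) (tgt Z) b' b)
            \<otimes>\<^bsub>Mor C (cone K X) (cone K Z)\<^esub>
            cmp C (cone K X) (tgt Z) (cone K Z) (cone_in K Z)
              (cmp C (cone K X) (src X) (tgt Z) x (cone_out K X))"
begin

lemmas cone_triangle = cone_triangle[OF cones]

lemmas cone_closed = cone_closed[OF cones]

text \<open>Vanishing of \<theta> on (X, Z), tested on representatives in Hom(A[1], B'). It makes
  \<sigma> strictly multiplicative on composites from X to Z, whatever the middle object is.\<close>

definition theta_null :: "('o, 'm) arrow \<Rightarrow> ('o, 'm) arrow \<Rightarrow> bool" where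
  "theta_null X Z \<longleftrightarrow> (\<forall>x\<in>hom_set C (src X) (tgt Z).
     cmp C (cone K X) (tgt Z) (cone K Z) (cone_in K Z)
       (cmp C (cone K X) (src X) (tgt Z) x (cone_out K X)) = zero_mor C (cone K X) (cone K Z))"

lemma cmp_lift:
  assumes "X \<in> Ob (arrow_category C)" "Y \<in> Ob (arrow_category C)" "Z \<in> Ob (arrow_category C)"
    "(a, b) \<in> hom_set (arrow_category C) X Y" "(a', b') \<in> hom_set (arrow_category C) Y Z"
    "theta_null X Z"
  shows "cmp C (cone K X) (cone K Y) (cone K Z) (\<sigma> Y Z a' b') (\<sigma> X Y a b)
    = \<sigma> X Z (cmp C (src X) (src Y) (src Z) a' a) (cmp C (tgt X) (tgt Y) (tgt Z) b' b)"
proof -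
  let ?a = "cmp C (src X) (src Y) (src Z) a' a" and ?b = "cmp C (tgt X) (tgt Y) (tgt Z) b' b"
  have "(?a, ?b) \<in> hom_set (arrow_category C) X Z"
    using arrow_category_cmp_closed[OF assms(1-5)] by simp
  then have "\<sigma> X Z ?a ?b \<in> hom_set C (cone K X) (cone K Z)"
    using lift[of X Z ?a ?b] assms by simp
  then show ?thesis
    using lift_cmp[OF assms(1-5)] assms(6) cone_closed[OF assms(1)] cone_closed[OF assms(3)]
    by (auto simp: theta_null_def)
qed

text \<open>The lift of the identity is idempotent by \<open>cmp_lift\<close>, and the only
  idempotent lift of the identity is the identity.\<close>

lemma lift_ide:
  assumes "X \<in> Ob (arrow_category C)" "theta_null X X"
  shows "\<sigma> X X (ide C (src X)) (ide C (tgt X)) = ide C (cone K X)"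
proof -
  note [simp] = assms(1)[simplified] cat_simps cone_closed[OF assms(1)]
  have "(ide C (src X), ide C (tgt X)) \<in> hom_set (arrow_category C) X X" by simp
  note l = lift[OF assms(1,1) this] cmp_lift[OF assms(1,1,1) this this assms(2)]
  show ?thesis
    by (rule cone_idempotent_eq_ide[OF cone_triangle[OF assms(1)]]) (use l in auto)
qed

text \<open>The lift z of 0 satisfies z = z z by \<open>cmp_lift\<close>, and z z = 0 because z lies
  in the square zero kernel.\<close>

lemma lift_zero:
  assumes "X \<in> Ob (arrow_category C)" "theta_null X X"
  shows "\<sigma> X X (zero_mor C (src X) (src X)) (zero_mor C (tgt X) (tgt X))
    = zero_mor C (cone K X) (cone K X)"
proof -
  let ?z = "\<sigma> X X (zero_mor C (src X) (src X)) (zero_mor C (tgt X) (tgt X))"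
  note [simp] = assms(1)[simplified] cat_simps cone_closed[OF assms(1)]
  have "(zero_mor C (src X) (src X), zero_mor C (tgt X) (tgt X)) \<in> hom_set (arrow_category C) X X"
    by simp
  note l = lift[OF assms(1,1) this] cmp_lift[OF assms(1,1,1) this this assms(2)]
  have "cmp C (cone K X) (cone K X) (cone K X) ?z ?z = zero_mor C (cone K X) (cone K X)"
    by (rule cone_square_zero[OF cone_triangle[OF assms(1)]]) (use l in auto)
  then show ?thesis using l by simp
qed

section \<open>Additivity of the lift on endomorphisms of multiplication by 2\<close>

definition double_arrow :: "'o \<Rightarrow> ('o, 'm) arrow" where
  "double_arrow A = \<lparr>src = A, tgt = A, arr = double_ide A\<rparr>"

lemma double_arrow_simps [simp]:
  "src (double_arrow A) = A" "tgt (double_arrow A) = A" "arr (double_arrow A) = double_ide A"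
  by (simp_all add: double_arrow_def)

text \<open>A functor that preserves a biproduct is additive: the sum is the fold map r = p + q
  after the pairing (m, n). Only composites from X to X are evaluated by \<sigma>; the biproduct
  relation on W comes from idempotence instead.\<close>

lemma lift_add:
  assumes A: "A \<in> Ob C" and X: "X = double_arrow A" and null: "theta_null X X"
    and ab: "(a, b) \<in> hom_set (arrow_category C) X X" "(a', b') \<in> hom_set (arrow_category C) X X"
  shows "\<sigma> X X (a \<otimes>\<^bsub>Mor C A A\<^esub> a') (b \<otimes>\<^bsub>Mor C A A\<^esub> b')
    = \<sigma> X X a b \<otimes>\<^bsub>Mor C (cone K X) (cone K X)\<^esub> \<sigma> X X a' b'"
proof -
  obtain B i j p q where "biproduct C A A B i j p q"
    using ex_biproduct[OF A A] by blast
  then have B [simp]: "B \<in> Ob C" and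
    hB [simp]: "i \<in> hom_set C A B" "j \<in> hom_set C A B" "p \<in> hom_set C B A" "q \<in> hom_set C B A" and
    eq [simp]: "cmp C A B A p i = ide C A" "cmp C A B A q j = ide C A"
      "cmp C A B A q i = zero_mor C A A" "cmp C A B A p j = zero_mor C A A" and
    sum: "cmp C B A B i p \<otimes>\<^bsub>Mor C B B\<^esub> cmp C B A B j q = ide C B"
    by (auto simp: biproduct_def)
  define W where "W = double_arrow B"
  have sX [simp]: "src X = A" "tgt X = A" "arr X = double_ide A" by (simp_all add: X)
  have sW [simp]: "src W = B" "tgt W = B" "arr W = double_ide B" by (simp_all add: W_def)
  have XO: "X \<in> Ob (arrow_category C)" and WO: "W \<in> Ob (arrow_category C)"
    using A by (simp_all add: double_ide_closed)
  note [simp] = A double_ide_closed ide_closed cmp_closed cmp_ide_left cmp_ide_right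
  let ?c = "cone K X" and ?d = "cone K W"
  let ?u = "cone_in K X" and ?v = "cone_out K X" and ?u' = "cone_in K W" and ?v' = "cone_out K W"
  have cX [simp]: "?c \<in> Ob C" "?u \<in> hom_set C A ?c" "?v \<in> hom_set C ?c A"
    using cone_closed[OF XO] by simp_all
  have cW [simp]: "?d \<in> Ob C" "?u' \<in> hom_set C B ?d" "?v' \<in> hom_set C ?d B"
    using cone_closed[OF WO] by simp_all
  have ab' [simp]: "a \<in> hom_set C A A" "b \<in> hom_set C A A" "a' \<in> hom_set C A A" "b' \<in> hom_set C A A"
    using ab by simp_all
  \<comment> \<open>Multiplication by 2 commutes with every f, so (f, f) is a morphism between
    double arrows.\<close>
  have diag: "(f, f) \<in> hom_set (arrow_category C) X W" if "f \<in> hom_set C A B" for f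
    using that by (simp add: cmp_double_ide_left cmp_double_ide_right)
  have diag': "(f, f) \<in> hom_set (arrow_category C) W X" if "f \<in> hom_set C B A" for f
    using that by (simp add: cmp_double_ide_left cmp_double_ide_right)
  note homs = diag[OF hB(1)] diag[OF hB(2)] diag'[OF hB(3)] diag'[OF hB(4)]
  let ?i = "\<sigma> X W i i" and ?j = "\<sigma> X W j j" and ?p = "\<sigma> W X p p" and ?q = "\<sigma> W X q q"
  note Ti = lift[OF XO WO homs(1)] and Tj = lift[OF XO WO homs(2)]
    and Tp = lift[OF WO XO homs(3)] and Tq = lift[OF WO XO homs(4)]
  have l [simp]: "?i \<in> hom_set C ?c ?d" "?j \<in> hom_set C ?c ?d" "?p \<in> hom_set C ?d ?c" "?q \<in> hom_set C ?d ?c"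
    using Ti Tj Tp Tq by simp_all
  \<comment> \<open>These four composites run from X to X, so the lifts satisfy the same relations
    as i, j, p, q.\<close>
  have pi [simp]: "cmp C ?c ?d ?c ?p ?i = ide C ?c" "cmp C ?c ?d ?c ?q ?j = ide C ?c"
     "cmp C ?c ?d ?c ?q ?i = zero_mor C ?c ?c" "cmp C ?c ?d ?c ?p ?j = zero_mor C ?c ?c"
    using cmp_lift[OF XO WO XO homs(1) homs(3) null] cmp_lift[OF XO WO XO homs(2) homs(4) null]
      cmp_lift[OF XO WO XO homs(1) homs(4) null] cmp_lift[OF XO WO XO homs(2) homs(3) null]
      lift_ide[OF XO null] lift_zero[OF XO null] by simp_all
  \<comment> \<open>The sum that must be 1 for the lifts to form a biproduct. Its summands run from
    W to W, where \<open>null\<close> says nothing.\<close>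
  define e where "e = cmp C ?d ?c ?d ?i ?p \<otimes>\<^bsub>Mor C ?d ?d\<^esub> cmp C ?d ?c ?d ?j ?q"
  have e [simp]: "e \<in> hom_set C ?d ?d" by (simp add: e_def)
  have p_e: "cmp C ?d ?d ?c ?p e = ?p" and q_e: "cmp C ?d ?d ?c ?q e = ?q"
    by (simp_all add: e_def cmp_add_right flip: cmp_assoc)
  have e_W: "e = ide C ?d"
  proof (rule cone_idempotent_eq_ide[OF cone_triangle[OF WO]])
    show "e \<in> hom_set C ?d ?d" by simp
    \<comment> \<open>The summands are third components of morphisms of triangles over i p and j q;
      since i p + j q = 1, \<open>e\<close> lifts the identity of W.\<close>
    have "cmp C B ?d ?d (cmp C ?d ?c ?d ?i ?p) ?u' = cmp C B B ?d ?u' (cmp C B A B i p)"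
      "cmp C B ?d ?d (cmp C ?d ?c ?d ?j ?q) ?u' = cmp C B B ?d ?u' (cmp C B A B j q)"
      "cmp C ?d ?d B ?v' (cmp C ?d ?c ?d ?i ?p) = cmp C ?d B B (cmp C B A B i p) ?v'"
      "cmp C ?d ?d B ?v' (cmp C ?d ?c ?d ?j ?q) = cmp C ?d B B (cmp C B A B j q) ?v'"
      using Triangles0_cmp_closed[OF cones WO XO WO Tp Ti]
        Triangles0_cmp_closed[OF cones WO XO WO Tq Tj] by simp_all
    note T = this
    have "cmp C B ?d ?d e ?u' = cmp C B B ?d ?u' (cmp C B A B i p \<otimes>\<^bsub>Mor C B B\<^esub> cmp C B A B j q)"
      unfolding e_def by (simp add: cmp_add_left cmp_add_right T)
    then show "cmp C (tgt W) ?d ?d e ?u' = ?u'" by (simp add: sum)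
    have "cmp C ?d ?d B ?v' e = cmp C ?d B B (cmp C B A B i p \<otimes>\<^bsub>Mor C B B\<^esub> cmp C B A B j q) ?v'"
      unfolding e_def by (simp add: cmp_add_left cmp_add_right T)
    then show "cmp C ?d ?d (src W) ?v' e = ?v'" by (simp add: sum)
    \<comment> \<open>Only the left factor is unfolded; \<sigma>(p) e = \<sigma>(p) and \<sigma>(q)
      e = \<sigma>(q) then give back \<open>e\<close>.\<close>
    have "cmp C ?d ?d ?d e e = cmp C ?d ?c ?d ?i (cmp C ?d ?d ?c ?p e)
        \<otimes>\<^bsub>Mor C ?d ?d\<^esub> cmp C ?d ?c ?d ?j (cmp C ?d ?d ?c ?q e)"
      by (subst (1) e_def) (simp add: cmp_add_left cmp_assoc)
    then show "cmp C ?d ?d ?d e e = e" by (simp only: p_e q_e) (simp only: e_def)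
  qed
  \<comment> \<open>The pairings of a with a' and of b with b'. They need not be equal; (m, n) is a
    morphism of arrows because the squares of (a, b) and (a', b') say b + b = a + a and b' + b' = a'
    + a'.\<close>
  define m n where "m = cmp C A A B i a \<otimes>\<^bsub>Mor C A B\<^esub> cmp C A A B j a'"
    and "n = cmp C A A B i b \<otimes>\<^bsub>Mor C A B\<^esub> cmp C A A B j b'"
  have m [simp]: "m \<in> hom_set C A B" "n \<in> hom_set C A B" by (simp_all add: m_def n_def)
  have proj: "cmp C A B A p m = a" "cmp C A B A q m = a'" "cmp C A B A p n = b" "cmp C A B A q n = b'"
    by (simp_all add: m_def n_def cmp_add_right flip: cmp_assoc)
  have comm: "b \<otimes>\<^bsub>Mor C A A\<^esub> b = a \<otimes>\<^bsub>Mor C A A\<^esub> a" "b' \<otimes>\<^bsub>Mor C A A\<^esub> b' = a' \<otimes>\<^bsub>Mor C A A\<^esub> a'"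
    using ab by (simp_all add: cmp_double_ide_left cmp_double_ide_right)
  interpret AB: comm_group "Mor C A B" by (simp add: hom_comm_group)
  have "n \<otimes>\<^bsub>Mor C A B\<^esub> n = cmp C A A B i (b \<otimes>\<^bsub>Mor C A A\<^esub> b) \<otimes>\<^bsub>Mor C A B\<^esub> cmp C A A B j (b' \<otimes>\<^bsub>Mor C A A\<^esub> b')"
    by (simp add: n_def cmp_add_right AB.m_ac)
  also have "\<dots> = m \<otimes>\<^bsub>Mor C A B\<^esub> m"
    by (simp add: m_def cmp_add_right AB.m_ac comm)
  finally have mn: "(m, n) \<in> hom_set (arrow_category C) X W"
    by (simp add: cmp_double_ide_left cmp_double_ide_right)
  let ?m = "\<sigma> X W m n"
  have Tm [simp]: "?m \<in> hom_set C ?c ?d" using lift[OF XO WO mn] by simp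
  have Tab [simp]: "\<sigma> X X a b \<in> hom_set C ?c ?c" "\<sigma> X X a' b' \<in> hom_set C ?c ?c"
    using lift[OF XO XO ab(1)] lift[OF XO XO ab(2)] by simp_all
  have pm: "cmp C ?c ?d ?c ?p ?m = \<sigma> X X a b" "cmp C ?c ?d ?c ?q ?m = \<sigma> X X a' b'"
    using cmp_lift[OF XO WO XO mn homs(3) null] cmp_lift[OF XO WO XO mn homs(4) null]
    by (simp_all add: proj)
  define r where "r = p \<otimes>\<^bsub>Mor C B A\<^esub> q"
  have r [simp]: "r \<in> hom_set C B A" by (simp add: r_def)
  let ?r = "\<sigma> W X r r"
  have Tr [simp]: "?r \<in> hom_set C ?d ?c" using lift[OF WO XO diag'[OF r]] by simp
  have ri: "cmp C ?c ?d ?c ?r ?i = ide C ?c" "cmp C ?c ?d ?c ?r ?j = ide C ?c"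
    using cmp_lift[OF XO WO XO homs(1) diag'[OF r] null] cmp_lift[OF XO WO XO homs(2) diag'[OF r] null]
      lift_ide[OF XO null] by (simp_all add: r_def cmp_add_left)
  have rm: "cmp C A B A r m = a \<otimes>\<^bsub>Mor C A A\<^esub> a'" "cmp C A B A r n = b \<otimes>\<^bsub>Mor C A A\<^esub> b'"
    by (simp_all add: r_def cmp_add_left proj)
  \<comment> \<open>Inserting e = 1 and using \<sigma>(r) \<sigma>(i) = \<sigma>(r) \<sigma>(j) = 1
    shows \<sigma>(r) = \<sigma>(p) + \<sigma>(q).\<close>
  have "?r = cmp C ?d ?d ?c ?r e" by (simp add: e_W)
  also have "\<dots> = ?p \<otimes>\<^bsub>Mor C ?d ?c\<^esub> ?q"
    by (simp add: e_def cmp_add_right ri flip: cmp_assoc)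
  finally have "cmp C ?c ?d ?c ?r ?m = \<sigma> X X a b \<otimes>\<^bsub>Mor C ?c ?c\<^esub> \<sigma> X X a' b'"
    by (simp add: cmp_add_left pm)
  then show ?thesis
    using cmp_lift[OF XO WO XO mn diag'[OF r] null] by (simp add: rm)
qed

theorem double_ide_eq_zero:
  assumes A: "A \<in> Ob C"
    and tri: "(A, A, A, double_ide A, double_ide A, double_ide A) \<in> \<D>"
    and four: "double_ide A \<otimes>\<^bsub>Mor C A A\<^esub> double_ide A = zero_mor C A A"
  shows "double_ide A = zero_mor C A A"
proof -
  obtain N where N: "zero_object C N" using ex_zero_object by blast
  note [simp] = zero_Ob[OF N] A double_ide_closed ide_closed cmp_closed cmp_ide_left cmp_ide_right
  let ?d = "double_ide A"
  have dd [simp]: "cmp C A A A ?d ?d = zero_mor C A A"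
    by (simp add: cmp_double_ide_left four)
  define X where "X = double_arrow A"
  have sX [simp]: "src X = A" "tgt X = A" "arr X = ?d" by (simp_all add: X_def)
  have XO: "X \<in> Ob (arrow_category C)" by simp
  let ?c = "cone K X" and ?u = "cone_in K X" and ?v = "cone_out K X"
  have cX [simp]: "?c \<in> Ob C" "?u \<in> hom_set C A ?c" "?v \<in> hom_set C ?c A"
    using cone_closed[OF XO] by simp_all
  have triX: "(A, A, ?c, ?d, ?u, ?v) \<in> \<D>" using cone_triangle[OF XO] by simp
  \<comment> \<open>\<open>TR5\<close> over the identities, in both directions: \<phi> 2 = u, v
    \<phi> = 2, \<psi> u = 2 and 2 \<psi> = v.\<close>
  obtain \<phi> where \<phi> [simp]: "\<phi> \<in> hom_set C A ?c" and "cmp C A A ?c \<phi> ?d = cmp C A A ?c ?u (ide C A)"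
    "cmp C A A A (ide C A) ?d = cmp C A ?c A ?v \<phi>"
    by (rule fill[OF tri triX, of "ide C A" "ide C A"]) auto
  then have \<phi>d: "cmp C A A ?c \<phi> ?d = ?u" and v\<phi>: "cmp C A ?c A ?v \<phi> = ?d" by simp_all
  obtain \<psi> where \<psi> [simp]: "\<psi> \<in> hom_set C ?c A" and "cmp C A ?c A \<psi> ?u = cmp C A A A ?d (ide C A)"
    "cmp C ?c A A (ide C A) ?v = cmp C ?c A A ?d \<psi>"
    by (rule fill[OF triX tri, of "ide C A" "ide C A"]) auto
  then have \<psi>u: "cmp C A ?c A \<psi> ?u = ?d" and d\<psi>: "cmp C ?c A A ?d \<psi> = ?v" by simp_all

  \<comment> \<open>u x v = \<phi> 2 x 2 \<psi>; one factor 2 moves past x and meets the other, and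
    2 2 = 0.\<close>
  have null: "theta_null X X"
  proof -
    have "cmp C ?c A ?c ?u (cmp C ?c A A x ?v) = zero_mor C ?c ?c" if [simp]: "x \<in> hom_set C A A" for x
    proof -
      have "cmp C ?c A A x ?v = cmp C ?c A A x (cmp C ?c A A ?d \<psi>)" by (simp add: d\<psi>)
      also have "\<dots> = cmp C ?c A A ?d (cmp C ?c A A x \<psi>)"
        by (simp add: cmp_double_ide_left cmp_add_right)
      finally have "cmp C ?c A ?c ?u (cmp C ?c A A x ?v)
          = cmp C ?c A ?c (cmp C A A ?c \<phi> ?d) (cmp C ?c A A ?d (cmp C ?c A A x \<psi>))"
        by (simp add: \<phi>d)
      also have "\<dots> = cmp C ?c A ?c \<phi> (cmp C ?c A A (cmp C A A A ?d ?d) (cmp C ?c A A x \<psi>))"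
        by (simp add: cmp_assoc del: dd)
      finally show ?thesis by simp
    qed
    then show ?thesis by (simp add: theta_null_def)
  qed

  define P where "P = \<lparr>src = A, tgt = N, arr = zero_mor C A N\<rparr>"
  have sP [simp]: "src P = A" "tgt P = N" "arr P = zero_mor C A N" by (simp_all add: P_def)
  have PO: "P \<in> Ob (arrow_category C)" by simp
  let ?cP = "cone K P" and ?vP = "cone_out K P"
  have cP [simp]: "?cP \<in> Ob C" "?vP \<in> hom_set C ?cP A"
    using cone_closed[OF PO] by simp_all
  have triP: "(A, N, ?cP, zero_mor C A N, cone_in K P, ?vP) \<in> \<D>" using cone_triangle[OF PO] by simp
  \<comment> \<open>(2, 0) is the composite X \<rightarrow> P \<rightarrow> X of (id, 0) and (2, 0).
    The square of the second morphism commutes because 2 2 = 0.\<close>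
  have k: "(ide C A, zero_mor C A N) \<in> hom_set (arrow_category C) X P"
    and f: "(?d, zero_mor C N A) \<in> hom_set (arrow_category C) P X" by simp_all
  let ?k = "\<sigma> X P (ide C A) (zero_mor C A N)" and ?f = "\<sigma> P X ?d (zero_mor C N A)"
  have kf [simp]: "?k \<in> hom_set C ?c ?cP" "?f \<in> hom_set C ?cP ?c"
    and vk: "cmp C ?c ?cP A ?vP ?k = ?v" and vf: "cmp C ?cP ?c A ?v ?f = cmp C ?cP A A ?d ?vP"
    using lift[OF XO PO k] lift[OF PO XO f] by simp_all
  obtain t where t [simp]: "t \<in> hom_set C A ?cP" and vt: "cmp C A ?cP A ?vP t = ide C A"
    using zero_second_section[OF triP N] .
  \<comment> \<open>\<open>?vP\<close> is left cancellable, and after it both sides become 2, by v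
    \<phi> = 2 on the left and by the section \<open>t\<close> on the right.\<close>
  have "cmp C A ?c ?cP ?k \<phi> = cmp C A A ?cP t ?d"
  proof (rule zero_second_mono[OF triP N])
    have "cmp C A ?cP A ?vP (cmp C A ?c ?cP ?k \<phi>) = ?d"
      by (simp add: vk v\<phi> flip: cmp_assoc)
    moreover have "cmp C A ?cP A ?vP (cmp C A A ?cP t ?d) = ?d"
      by (simp add: vt flip: cmp_assoc)
    ultimately show "cmp C A ?cP A ?vP (cmp C A ?c ?cP ?k \<phi>) = cmp C A ?cP A ?vP (cmp C A A ?cP t ?d)"
      by simp
  qed simp_all
  moreover have f_k: "cmp C ?c ?cP ?c ?f ?k = \<sigma> X X ?d (zero_mor C A A)"
    using cmp_lift[OF XO PO XO k f null] by simp
  ultimately have "cmp C A ?c A \<psi> (cmp C A ?c ?c (\<sigma> X X ?d (zero_mor C A A)) \<phi>)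
      = cmp C A ?c A \<psi> (cmp C A ?cP ?c ?f (cmp C A A ?cP t ?d))"
    by (simp add: cmp_assoc flip: f_k)
  \<comment> \<open>The factor 2 is moved to the front, where 2 \<psi> = v; then v f = 2 vP and vP t
    = 1 leave just 2.\<close>
  also have "\<dots> = cmp C A A A ?d (cmp C A ?c A \<psi> (cmp C A ?cP ?c ?f t))"
    by (simp add: cmp_double_ide_left cmp_double_ide_right cmp_add_right)
  also have "\<dots> = cmp C A ?cP A (cmp C ?cP ?c A (cmp C ?c A A ?d \<psi>) ?f) t"
    by (simp add: cmp_assoc)
  also have "\<dots> = cmp C A ?cP A (cmp C ?cP A A ?d ?vP) t"
    by (simp add: d\<psi> vf)
  also have "\<dots> = ?d" by (simp add: cmp_assoc vt)
  finally have e1: "cmp C A ?c A \<psi> (cmp C A ?c ?c (\<sigma> X X ?d (zero_mor C A A)) \<phi>) = ?d" .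

  define Q where "Q = \<lparr>src = N, tgt = A, arr = zero_mor C N A\<rparr>"
  have sQ [simp]: "src Q = N" "tgt Q = A" "arr Q = zero_mor C N A" by (simp_all add: Q_def)
  have QO: "Q \<in> Ob (arrow_category C)" by simp
  let ?cQ = "cone K Q" and ?uQ = "cone_in K Q"
  have cQ [simp]: "?cQ \<in> Ob C" "?uQ \<in> hom_set C A ?cQ"
    using cone_closed[OF QO] by simp_all
  have triQ: "(N, A, ?cQ, zero_mor C N A, ?uQ, cone_out K Q) \<in> \<D>" using cone_triangle[OF QO] by simp
  \<comment> \<open>Dually, (0, 2) is the composite X \<rightarrow> Q \<rightarrow> X of (0, 2) and
    (0, id); here 2 2 = 0 is needed for the first square.\<close>
  have g: "(zero_mor C A N, ?d) \<in> hom_set (arrow_category C) X Q"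
    and l: "(zero_mor C N A, ide C A) \<in> hom_set (arrow_category C) Q X" by simp_all
  let ?g = "\<sigma> X Q (zero_mor C A N) ?d" and ?l = "\<sigma> Q X (zero_mor C N A) (ide C A)"
  have gl [simp]: "?g \<in> hom_set C ?c ?cQ" "?l \<in> hom_set C ?cQ ?c"
    and gu: "cmp C A ?c ?cQ ?g ?u = cmp C A A ?cQ ?uQ ?d" and lu: "cmp C A ?cQ ?c ?l ?uQ = ?u"
    using lift[OF XO QO g] lift[OF QO XO l] by simp_all
  obtain r where r [simp]: "r \<in> hom_set C ?cQ A" and ru: "cmp C A ?cQ A r ?uQ = ide C A"
    using zero_first_retraction[OF triQ N] .
  \<comment> \<open>\<open>?uQ\<close> is right cancellable; both sides become 2 after
    precomposition with it, by \<psi> u = 2 and the retraction \<open>r\<close>.\<close>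
  have \<psi>l: "cmp C ?cQ ?c A \<psi> ?l = cmp C ?cQ A A ?d r"
  proof (rule zero_first_epi[OF triQ N])
    show "cmp C A ?cQ A (cmp C ?cQ ?c A \<psi> ?l) ?uQ = cmp C A ?cQ A (cmp C ?cQ A A ?d r) ?uQ"
      by (simp add: cmp_assoc lu \<psi>u ru)
  qed simp_all
  have l_g: "cmp C ?c ?cQ ?c ?l ?g = \<sigma> X X (zero_mor C A A) ?d"
    using cmp_lift[OF XO QO XO g l null] by simp
  have "cmp C A ?c A \<psi> (cmp C A ?c ?c (\<sigma> X X (zero_mor C A A) ?d) \<phi>)
      = cmp C A ?cQ A (cmp C ?cQ ?c A \<psi> ?l) (cmp C A ?c ?cQ ?g \<phi>)"
    by (simp add: cmp_assoc flip: l_g)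
  \<comment> \<open>This time 2 moves to the right, where \<phi> 2 = u; then g u = uQ 2 and r uQ =
    1.\<close>
  also have "\<dots> = cmp C A A A (cmp C A ?cQ A r (cmp C A ?c ?cQ ?g \<phi>)) ?d"
    by (simp add: \<psi>l cmp_assoc cmp_double_ide_left cmp_double_ide_right cmp_add_left cmp_add_right)
  also have "\<dots> = cmp C A ?cQ A r (cmp C A ?c ?cQ ?g (cmp C A A ?c \<phi> ?d))"
    by (simp add: cmp_assoc)
  also have "\<dots> = cmp C A A A (cmp C A ?cQ A r ?uQ) ?d"
    by (simp add: \<phi>d gu cmp_assoc)
  also have "\<dots> = ?d" by (simp add: ru)
  finally have e2: "cmp C A ?c A \<psi> (cmp C A ?c ?c (\<sigma> X X (zero_mor C A A) ?d) \<phi>) = ?d" .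

  have h: "(?d, zero_mor C A A) \<in> hom_set (arrow_category C) X X"
    "(zero_mor C A A, ?d) \<in> hom_set (arrow_category C) X X"
    "(ide C A, ide C A) \<in> hom_set (arrow_category C) X X"
    by simp_all
  have s [simp]: "\<sigma> X X ?d (zero_mor C A A) \<in> hom_set C ?c ?c" "\<sigma> X X (zero_mor C A A) ?d \<in> hom_set C ?c ?c"
    using lift[OF XO XO h(1)] lift[OF XO XO h(2)] by simp_all
  \<comment> \<open>(2, 2) is decomposed in two ways: as (2, 0) + (0, 2) and as (1, 1) + (1, 1), the
    latter lifting to 2 on the cone.\<close>
  have "\<sigma> X X ?d (zero_mor C A A) \<otimes>\<^bsub>Mor C ?c ?c\<^esub> \<sigma> X X (zero_mor C A A) ?d = \<sigma> X X ?d ?d"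
    using lift_add[OF A X_def null h(1,2)] by simp
  also have "\<dots> = double_ide ?c"
    using lift_add[OF A X_def null h(3,3)] lift_ide[OF XO null] by (simp add: double_ide_def)
  finally have "cmp C A ?c A \<psi> (cmp C A ?c ?c (double_ide ?c) \<phi>)
      = cmp C A ?c A \<psi> (cmp C A ?c ?c (\<sigma> X X ?d (zero_mor C A A)
          \<otimes>\<^bsub>Mor C ?c ?c\<^esub> \<sigma> X X (zero_mor C A A) ?d) \<phi>)"
    by simp
  also have "\<dots> = ?d \<otimes>\<^bsub>Mor C A A\<^esub> ?d"
    by (simp add: cmp_add_left cmp_add_right e1 e2)
  finally have "cmp C A ?c A \<psi> (cmp C A ?c ?c (double_ide ?c) \<phi>) = ?d \<otimes>\<^bsub>Mor C A A\<^esub> ?d" .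
  \<comment> \<open>The same expression is (2 \<psi>) \<phi> = v \<phi> = 2, against 2 + 2 = 0 from
    the decomposition.\<close>
  moreover have "cmp C A ?c A \<psi> (cmp C A ?c ?c (double_ide ?c) \<phi>) = cmp C A ?c A (cmp C ?c A A ?d \<psi>) \<phi>"
    by (simp add: cmp_double_ide_left cmp_add_right cmp_add_left)
  ultimately show ?thesis by (simp add: four d\<psi> v\<phi>)
qed

end

section \<open>From extensions and cocycles to lifts\<close>

lemma Triangles0_mult [simp]:
  "(a, b, c) \<otimes>\<^bsub>Mor (Triangles0 C S K) X Y\<^esub> (a', b', c')
    = (a \<otimes>\<^bsub>Mor C (src X) (src Y)\<^esub> a', b \<otimes>\<^bsub>Mor C (tgt X) (tgt Y)\<^esub> b',
       c \<otimes>\<^bsub>Mor C (cone K X) (cone K Y)\<^esub> c')"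
  by (simp add: Triangles0_def DirProd_def)

lemma Triangles0_proj_simps [simp]:
  "fob Triangles0_proj X = X" "fmor Triangles0_proj X Y (a, b, c) = (a, b)"
  by (simp_all add: Triangles0_proj_def)

section \<open>Representatives of second cohomology classes\<close>

lemma cochains2_group:
  assumes "\<And>X Y. X \<in> Ob B \<Longrightarrow> Y \<in> Ob B \<Longrightarrow> group (bval D X Y)"
  shows "group (cochains2 B D)"
  unfolding cochains2_def using assms by (intro product_group) (auto simp: strings2_def)

text \<open>It is the coboundary of the zero 1-cochain; the assumptions are what this one
  computation uses.\<close>

lemma one_in_coboundaries2:
  assumes grp: "\<And>X Y. X \<in> Ob B \<Longrightarrow> Y \<in> Ob B \<Longrightarrow> group (bval D X Y)"
    and cmp: "\<And>X Y Z f g. \<lbrakk>X \<in> Ob B; Y \<in> Ob B; Z \<in> Ob B; f \<in> hom_set B X Y; g \<in> hom_set B Y Z\<rbrakk>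
      \<Longrightarrow> cmp B X Y Z g f \<in> hom_set B X Z"
    and post: "\<And>X Y Z g. \<lbrakk>X \<in> Ob B; Y \<in> Ob B; Z \<in> Ob B; g \<in> hom_set B Y Z\<rbrakk>
      \<Longrightarrow> bpost D X Y Z g \<one>\<^bsub>bval D X Y\<^esub> = \<one>\<^bsub>bval D X Z\<^esub>"
    and pre: "\<And>X Y Z f. \<lbrakk>X \<in> Ob B; Y \<in> Ob B; Z \<in> Ob B; f \<in> hom_set B X Y\<rbrakk>
      \<Longrightarrow> bpre D X Y Z f \<one>\<^bsub>bval D Y Z\<^esub> = \<one>\<^bsub>bval D X Z\<^esub>"
  shows "\<one>\<^bsub>cochains2 B D\<^esub> \<in> coboundaries2 B D"
proof -
  have "coboundary1 B D \<one>\<^bsub>cochains1 B D\<^esub> = \<one>\<^bsub>cochains2 B D\<^esub>"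
    using grp post pre cmp
    by (auto simp: coboundary1_def cochains1_def cochains2_def strings1_def strings2_def
        group.is_monoid monoid.inv_one fun_eq_iff restrict_def)
  moreover have "\<one>\<^bsub>cochains1 B D\<^esub> \<in> carrier (cochains1 B D)"
    using grp by (auto simp: cochains1_def strings1_def group.is_monoid)
  ultimately show ?thesis unfolding coboundaries2_def by (metis imageI)
qed

text \<open>Zero is a coboundary, so the coset \<eta> contains its representative c, and its image
  contains t c itself. This replaces a statement on cosets by one on a single cochain.\<close>

lemma HH2_map_representative:
  assumes D: "\<And>X Y. X \<in> Ob B \<Longrightarrow> Y \<in> Ob B \<Longrightarrow> group (bval D X Y)"
    and D': "\<And>X Y. X \<in> Ob B \<Longrightarrow> Y \<in> Ob B \<Longrightarrow> group (bval D' X Y)"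
    and t: "\<And>X Y d. \<lbrakk>X \<in> Ob B; Y \<in> Ob B; d \<in> carrier (bval D X Y)\<rbrakk> \<Longrightarrow> t X Y d \<in> carrier (bval D' X Y)"
    and one: "\<one>\<^bsub>cochains2 B D\<^esub> \<in> coboundaries2 B D" "\<one>\<^bsub>cochains2 B D'\<^esub> \<in> coboundaries2 B D'"
    and \<eta>: "\<eta> \<in> carrier (HH2 B D)"
  obtains c where "c \<in> carrier (cochains2 B D)"
    "restrict (\<lambda>(X, Y, Z, f, g). t X Z (c (X, Y, Z, f, g))) (strings2 B) \<in> HH2_map B D' t \<eta>"
proof -
  obtain c where "c \<in> cocycles2 B D" and c\<eta>: "\<eta> = coboundaries2 B D #>\<^bsub>cochains2 B D\<^esub> c"
    using \<eta> by (auto simp: HH2_def carrier_FactGroup r_coset_def)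
  then have c: "c \<in> carrier (cochains2 B D)" by (simp add: cocycles2_def kernel_def)
  interpret G: group "cochains2 B D" using D by (rule cochains2_group)
  interpret G': group "cochains2 B D'" using D' by (rule cochains2_group)
  let ?tc = "restrict (\<lambda>(X, Y, Z, f, g). t X Z (c (X, Y, Z, f, g))) (strings2 B)"
  have "c \<in> \<eta>" using one(1) c by (force simp: c\<eta> r_coset_def)
  moreover have "?tc \<in> carrier (cochains2 B D')"
    using c t by (fastforce simp: cochains2_def strings2_def PiE_iff)
  ultimately have "\<one>\<^bsub>cochains2 B D'\<^esub> \<otimes>\<^bsub>cochains2 B D'\<^esub> ?tc \<in> HH2_map B D' t \<eta>"
    using one(2) unfolding HH2_map_def set_mult_def by blast
  then show thesis using that c \<open>?tc \<in> _\<close> by simp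
qed

section \<open>The Toda bifunctor\<close>

context untranslated_triangulated_category
begin

lemma Toda_indeterminacy_subgroup:
  assumes "X \<in> Ob (arrow_category C)" "Y \<in> Ob (arrow_category C)"
  shows "subgroup (Toda_indeterminacy C id_functor X Y) (Mor C (src X) (tgt Y))"
proof -
  note [simp] = assms(1)[simplified] assms(2)[simplified]
  interpret G: comm_group "Mor C (src X) (tgt Y)" by (simp add: hom_comm_group)
  have sub: "cmp C (src X) (src Y) (tgt Y) (arr Y) g \<otimes>\<^bsub>Mor C (src X) (tgt Y)\<^esub>
      inv\<^bsub>Mor C (src X) (tgt Y)\<^esub> cmp C (src X) (tgt X) (tgt Y) h (arr X)
      \<in> Toda_indeterminacy C id_functor X Y"
    if "g \<in> hom_set C (src X) (src Y)" "h \<in> hom_set C (tgt X) (tgt Y)" for g h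
    using that by (auto simp: Toda_indeterminacy_def)
  show ?thesis
  proof (rule G.subgroupI)
    show "Toda_indeterminacy C id_functor X Y \<subseteq> hom_set C (src X) (tgt Y)"
      by (auto simp: Toda_indeterminacy_def cmp_closed)
    show "Toda_indeterminacy C id_functor X Y \<noteq> {}"
      using sub[of "zero_mor C (src X) (src Y)" "zero_mor C (tgt X) (tgt Y)"] by auto
  next
    fix x assume "x \<in> Toda_indeterminacy C id_functor X Y"
    then obtain g h where gh: "g \<in> hom_set C (src X) (src Y)" "h \<in> hom_set C (tgt X) (tgt Y)" and
      x: "x = cmp C (src X) (src Y) (tgt Y) (arr Y) g \<otimes>\<^bsub>Mor C (src X) (tgt Y)\<^esub>
        inv\<^bsub>Mor C (src X) (tgt Y)\<^esub> cmp C (src X) (tgt X) (tgt Y) h (arr X)"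
      by (auto simp: Toda_indeterminacy_def)
    show "inv\<^bsub>Mor C (src X) (tgt Y)\<^esub> x \<in> Toda_indeterminacy C id_functor X Y"
      using sub[of "inv\<^bsub>Mor C (src X) (src Y)\<^esub> g" "inv\<^bsub>Mor C (tgt X) (tgt Y)\<^esub> h"] gh
      by (simp add: x cmp_neg_left cmp_neg_right cmp_closed G.inv_mult)
  next
    fix x x' assume "x \<in> Toda_indeterminacy C id_functor X Y" "x' \<in> Toda_indeterminacy C id_functor X Y"
    then obtain g h g' h' where gh: "g \<in> hom_set C (src X) (src Y)" "h \<in> hom_set C (tgt X) (tgt Y)"
      "g' \<in> hom_set C (src X) (src Y)" "h' \<in> hom_set C (tgt X) (tgt Y)" and
      x: "x = cmp C (src X) (src Y) (tgt Y) (arr Y) g \<otimes>\<^bsub>Mor C (src X) (tgt Y)\<^esub>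
        inv\<^bsub>Mor C (src X) (tgt Y)\<^esub> cmp C (src X) (tgt X) (tgt Y) h (arr X)"
      "x' = cmp C (src X) (src Y) (tgt Y) (arr Y) g' \<otimes>\<^bsub>Mor C (src X) (tgt Y)\<^esub>
        inv\<^bsub>Mor C (src X) (tgt Y)\<^esub> cmp C (src X) (tgt X) (tgt Y) h' (arr X)"
      by (auto simp: Toda_indeterminacy_def)
    show "x \<otimes>\<^bsub>Mor C (src X) (tgt Y)\<^esub> x' \<in> Toda_indeterminacy C id_functor X Y"
      using sub[of "g \<otimes>\<^bsub>Mor C (src X) (src Y)\<^esub> g'" "h \<otimes>\<^bsub>Mor C (tgt X) (tgt Y)\<^esub> h'"] gh
      by (simp add: x cmp_add_left cmp_add_right cmp_closed G.inv_mult G.m_ac)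
  qed
qed

lemma Toda_bval_group:
  assumes "X \<in> Ob (arrow_category C)" "Y \<in> Ob (arrow_category C)"
  shows "group (bval (Toda C id_functor) X Y)"
proof -
  interpret G: comm_group "Mor C (src X) (tgt Y)"
    using assms by (simp add: hom_comm_group)
  show ?thesis
    using G.abelian_FactGroup[OF Toda_indeterminacy_subgroup[OF assms]]
    by (simp add: Toda_def comm_group.axioms(2))
qed

text \<open>The zero of a quotient is the indeterminacy itself. Postcomposition with b maps it into
  the indeterminacy of (X, Z), since b f' g = f'' (a g), and adding a subset of a subgroup that
  contains 0 returns the subgroup.\<close>

lemma Toda_post_one:
  assumes "X \<in> Ob (arrow_category C)" "Y \<in> Ob (arrow_category C)" "Z \<in> Ob (arrow_category C)"
    "f \<in> hom_set (arrow_category C) Y Z"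
  shows "bpost (Toda C id_functor) X Y Z f \<one>\<^bsub>bval (Toda C id_functor) X Y\<^esub>
    = \<one>\<^bsub>bval (Toda C id_functor) X Z\<^esub>"
proof -
  obtain a b where f: "f = (a, b)" by (cases f) auto
  note [simp] = assms(1)[simplified] assms(2)[simplified] assms(3)[simplified]
  have [simp]: "a \<in> hom_set C (src Y) (src Z)" "b \<in> hom_set C (tgt Y) (tgt Z)" and
    sq: "cmp C (src Y) (tgt Y) (tgt Z) b (arr Y) = cmp C (src Y) (src Z) (tgt Z) (arr Z) a"
    using assms(4) by (simp_all add: f)
  interpret G: comm_group "Mor C (src X) (tgt Z)" by (simp add: hom_comm_group)
  let ?I = "Toda_indeterminacy C id_functor"
  interpret I: subgroup "?I X Z" "Mor C (src X) (tgt Z)"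
    by (rule Toda_indeterminacy_subgroup[OF assms(1,3)])
  have "cmp C (src X) (tgt Y) (tgt Z) b x \<in> ?I X Z" if xI: "x \<in> ?I X Y" for x
  proof -
    obtain g h where gh [simp]: "g \<in> hom_set C (src X) (src Y)" "h \<in> hom_set C (tgt X) (tgt Y)" and
      x: "x = cmp C (src X) (src Y) (tgt Y) (arr Y) g \<otimes>\<^bsub>Mor C (src X) (tgt Y)\<^esub>
        inv\<^bsub>Mor C (src X) (tgt Y)\<^esub> cmp C (src X) (tgt X) (tgt Y) h (arr X)"
      using xI by (auto simp: Toda_indeterminacy_def)
    have "cmp C (src X) (tgt Y) (tgt Z) b (cmp C (src X) (src Y) (tgt Y) (arr Y) g)
        = cmp C (src X) (src Y) (tgt Z) (cmp C (src Y) (tgt Y) (tgt Z) b (arr Y)) g"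
      by (rule cmp_assoc[symmetric]) simp_all
    also have "\<dots> = cmp C (src X) (src Z) (tgt Z) (arr Z) (cmp C (src X) (src Y) (src Z) a g)"
      by (simp add: sq cmp_assoc)
    finally have "cmp C (src X) (tgt Y) (tgt Z) b x
      = cmp C (src X) (src Z) (tgt Z) (arr Z) (cmp C (src X) (src Y) (src Z) a g) \<otimes>\<^bsub>Mor C (src X) (tgt Z)\<^esub>
        inv\<^bsub>Mor C (src X) (tgt Z)\<^esub> cmp C (src X) (tgt X) (tgt Z) (cmp C (tgt X) (tgt Y) (tgt Z) b h) (arr X)"
      by (simp add: x cmp_add_right cmp_neg_right cmp_closed cmp_assoc)
    then show ?thesis by (auto simp: Toda_indeterminacy_def cmp_closed intro!: exI)
  qed
  moreover have "zero_mor C (src X) (tgt Y) \<in> ?I X Y"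
    by (rule subgroup.one_closed[OF Toda_indeterminacy_subgroup[OF assms(1,2)]])
  ultimately have "?I X Z <#>\<^bsub>Mor C (src X) (tgt Z)\<^esub>
      (cmp C (src X) (tgt Y) (tgt Z) b) ` ?I X Y = ?I X Z"
    by (force simp: set_mult_def)
  then show ?thesis by (simp add: f Toda_def)
qed

text \<open>Dual of \<open>Toda_post_one\<close>: the square now rewrites (h f) a as (h b)
  f.\<close>

lemma Toda_pre_one:
  assumes "X \<in> Ob (arrow_category C)" "Y \<in> Ob (arrow_category C)" "Z \<in> Ob (arrow_category C)"
    "f \<in> hom_set (arrow_category C) X Y"
  shows "bpre (Toda C id_functor) X Y Z f \<one>\<^bsub>bval (Toda C id_functor) Y Z\<^esub>
    = \<one>\<^bsub>bval (Toda C id_functor) X Z\<^esub>"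
proof -
  obtain a b where f: "f = (a, b)" by (cases f) auto
  note [simp] = assms(1)[simplified] assms(2)[simplified] assms(3)[simplified]
  have [simp]: "a \<in> hom_set C (src X) (src Y)" "b \<in> hom_set C (tgt X) (tgt Y)" and
    sq: "cmp C (src X) (tgt X) (tgt Y) b (arr X) = cmp C (src X) (src Y) (tgt Y) (arr Y) a"
    using assms(4) by (simp_all add: f)
  interpret G: comm_group "Mor C (src X) (tgt Z)" by (simp add: hom_comm_group)
  let ?I = "Toda_indeterminacy C id_functor"
  interpret I: subgroup "?I X Z" "Mor C (src X) (tgt Z)"
    by (rule Toda_indeterminacy_subgroup[OF assms(1,3)])
  have "cmp C (src X) (src Y) (tgt Z) x a \<in> ?I X Z" if xI: "x \<in> ?I Y Z" for x
  proof -
    obtain g h where gh [simp]: "g \<in> hom_set C (src Y) (src Z)" "h \<in> hom_set C (tgt Y) (tgt Z)" and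
      x: "x = cmp C (src Y) (src Z) (tgt Z) (arr Z) g \<otimes>\<^bsub>Mor C (src Y) (tgt Z)\<^esub>
        inv\<^bsub>Mor C (src Y) (tgt Z)\<^esub> cmp C (src Y) (tgt Y) (tgt Z) h (arr Y)"
      using xI by (auto simp: Toda_indeterminacy_def)
    have "cmp C (src X) (src Y) (tgt Z) (cmp C (src Y) (tgt Y) (tgt Z) h (arr Y)) a
        = cmp C (src X) (tgt Y) (tgt Z) h (cmp C (src X) (tgt X) (tgt Y) b (arr X))"
      by (simp add: sq cmp_assoc)
    also have "\<dots> = cmp C (src X) (tgt X) (tgt Z) (cmp C (tgt X) (tgt Y) (tgt Z) h b) (arr X)"
      by (rule cmp_assoc[symmetric]) simp_all
    finally have "cmp C (src X) (src Y) (tgt Z) x a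
      = cmp C (src X) (src Z) (tgt Z) (arr Z) (cmp C (src X) (src Y) (src Z) g a) \<otimes>\<^bsub>Mor C (src X) (tgt Z)\<^esub>
        inv\<^bsub>Mor C (src X) (tgt Z)\<^esub> cmp C (src X) (tgt X) (tgt Z) (cmp C (tgt X) (tgt Y) (tgt Z) h b) (arr X)"
      by (simp add: x cmp_add_left cmp_neg_left cmp_closed) (simp add: cmp_assoc)
    then show ?thesis by (auto simp: Toda_indeterminacy_def cmp_closed intro!: exI)
  qed
  moreover have "zero_mor C (src Y) (tgt Z) \<in> ?I Y Z"
    by (rule subgroup.one_closed[OF Toda_indeterminacy_subgroup[OF assms(2,3)]])
  ultimately have "?I X Z <#>\<^bsub>Mor C (src X) (tgt Z)\<^esub>
      (\<lambda>x. cmp C (src X) (src Y) (tgt Z) x a) ` ?I Y Z = ?I X Z"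
    by (force simp: set_mult_def)
  then show ?thesis by (simp add: f Toda_def)
qed

section \<open>The bifunctor \<Theta>, the transformation \<theta> and the reduction to
  lifts\<close>

context
  fixes K :: "('o, 'm) cones"
  assumes cones: "cone_choice C \<D> K"
begin

lemma Theta_subgroup:
  assumes "X \<in> Ob (arrow_category C)" "Y \<in> Ob (arrow_category C)"
  shows "subgroup (carrier (bval (Theta C id_functor K) X Y)) (Mor C (cone K X) (cone K Y))"
proof -
  note [simp] = cone_closed[OF cones assms(1)] cone_closed[OF cones assms(2)]
  interpret G: comm_group "Mor C (cone K X) (cone K Y)" by (simp add: hom_comm_group)
  show ?thesis
  proof (rule G.subgroupI)
    have "zero_mor C (cone K X) (cone K Y) \<in> carrier (bval (Theta C id_functor K) X Y)"
      by (simp add: Theta_def)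
    then show "carrier (bval (Theta C id_functor K) X Y) \<noteq> {}" by blast
  qed (auto simp: Theta_def cmp_add_left cmp_add_right cmp_neg_left cmp_neg_right)
qed

lemma Theta_bval_group:
  assumes "X \<in> Ob (arrow_category C)" "Y \<in> Ob (arrow_category C)"
  shows "group (bval (Theta C id_functor K) X Y)"
proof -
  have "group ((Mor C (cone K X) (cone K Y))\<lparr>carrier := carrier (bval (Theta C id_functor K) X Y)\<rparr>)"
    using cone_closed[OF cones assms(1)] cone_closed[OF cones assms(2)]
    by (intro subgroup.subgroup_is_group[OF Theta_subgroup[OF assms]] hom_group)
  then show ?thesis by (simp add: Theta_def)
qed

lemma Theta_bval_one [simp]: "\<one>\<^bsub>bval (Theta C id_functor K) X Y\<^esub> = zero_mor C (cone K X) (cone K Y)"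
  by (simp add: Theta_def)

text \<open>Fullness of \<pi>, an instance of \<open>TR5\<close>. It makes the sets under
  \<open>the_elem\<close> in \<open>Theta\<close> nonempty.\<close>

lemma ex_lift:
  assumes "X \<in> Ob (arrow_category C)" "Y \<in> Ob (arrow_category C)"
    "(a, b) \<in> hom_set (arrow_category C) X Y"
  obtains c where "(a, b, c) \<in> hom_set (Triangles0 C id_functor K) X Y"
proof -
  obtain c where "c \<in> hom_set C (cone K X) (cone K Y)"
    "cmp C (tgt X) (cone K X) (cone K Y) c (cone_in K X)
      = cmp C (tgt X) (tgt Y) (cone K Y) (cone_in K Y) b"
    "cmp C (cone K X) (src X) (src Y) a (cone_out K X)
      = cmp C (cone K X) (cone K Y) (src Y) (cone_out K Y) c"
    by (rule fill[OF cone_triangle[OF cones assms(1)] cone_triangle[OF cones assms(2)], of a b])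
       (use assms(3) in auto)
  then show thesis using assms(3) by (intro that[of c]) auto
qed

text \<open>Every lift sends 0 to 0, and a lift exists, so the set under \<open>the_elem\<close> is
  exactly the singleton of 0.\<close>

lemma Theta_post_one:
  assumes "X \<in> Ob (arrow_category C)" "Y \<in> Ob (arrow_category C)" "Z \<in> Ob (arrow_category C)"
    "f \<in> hom_set (arrow_category C) Y Z"
  shows "bpost (Theta C id_functor K) X Y Z f \<one>\<^bsub>bval (Theta C id_functor K) X Y\<^esub>
    = \<one>\<^bsub>bval (Theta C id_functor K) X Z\<^esub>"
proof -
  obtain a b where f: "f = (a, b)" by (cases f) auto
  note [simp] = cone_closed[OF cones assms(1)] cone_closed[OF cones assms(2)] cone_closed[OF cones assms(3)]
  obtain c where c: "(a, b, c) \<in> hom_set (Triangles0 C id_functor K) Y Z"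
    using ex_lift[OF assms(2,3), of a b] assms(4) unfolding f by blast
  have "{cmp C (cone K X) (cone K Y) (cone K Z) c' (zero_mor C (cone K X) (cone K Y)) |c'.
      (a, b, c') \<in> hom_set (Triangles0 C id_functor K) Y Z} = {zero_mor C (cone K X) (cone K Z)}"
  proof (intro equalityI subsetI)
    show "y \<in> {cmp C (cone K X) (cone K Y) (cone K Z) c' (zero_mor C (cone K X) (cone K Y)) |c'.
      (a, b, c') \<in> hom_set (Triangles0 C id_functor K) Y Z}" if "y \<in> {zero_mor C (cone K X) (cone K Z)}" for y
      using that c by (auto intro!: exI[of _ c])
  qed auto
  then show ?thesis by (simp only: f Theta_bval_one) (simp add: Theta_def)
qed

lemma Theta_pre_one:
  assumes "X \<in> Ob (arrow_category C)" "Y \<in> Ob (arrow_category C)" "Z \<in> Ob (arrow_category C)"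
    "f \<in> hom_set (arrow_category C) X Y"
  shows "bpre (Theta C id_functor K) X Y Z f \<one>\<^bsub>bval (Theta C id_functor K) Y Z\<^esub>
    = \<one>\<^bsub>bval (Theta C id_functor K) X Z\<^esub>"
proof -
  obtain a b where f: "f = (a, b)" by (cases f) auto
  note [simp] = cone_closed[OF cones assms(1)] cone_closed[OF cones assms(2)] cone_closed[OF cones assms(3)]
  obtain c where c: "(a, b, c) \<in> hom_set (Triangles0 C id_functor K) X Y"
    using ex_lift[OF assms(1,2), of a b] assms(4) unfolding f by blast
  have "{cmp C (cone K X) (cone K Y) (cone K Z) (zero_mor C (cone K Y) (cone K Z)) c' |c'.
      (a, b, c') \<in> hom_set (Triangles0 C id_functor K) X Y} = {zero_mor C (cone K X) (cone K Z)}"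
  proof (intro equalityI subsetI)
    show "y \<in> {cmp C (cone K X) (cone K Y) (cone K Z) (zero_mor C (cone K Y) (cone K Z)) c' |c'.
      (a, b, c') \<in> hom_set (Triangles0 C id_functor K) X Y}" if "y \<in> {zero_mor C (cone K X) (cone K Z)}" for y
      using that c by (auto intro!: exI[of _ c])
  qed auto
  then show ?thesis by (simp only: f Theta_bval_one) (simp add: Theta_def)
qed

text \<open>The inverse of a group depends on its carrier. It is computed in the full triple product
  and transferred along the subgroup of morphisms of triangles.\<close>

lemma Triangles0_inv:
  assumes "X \<in> Ob (arrow_category C)" "Y \<in> Ob (arrow_category C)"
    "(a, b, c) \<in> hom_set (Triangles0 C id_functor K) X Y"
  shows "inv\<^bsub>Mor (Triangles0 C id_functor K) X Y\<^esub> (a, b, c)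
    = (inv\<^bsub>Mor C (src X) (src Y)\<^esub> a, inv\<^bsub>Mor C (tgt X) (tgt Y)\<^esub> b,
       inv\<^bsub>Mor C (cone K X) (cone K Y)\<^esub> c)"
proof -
  note [simp] = assms(1)[simplified] assms(2)[simplified]
    cone_closed[OF cones assms(1)] cone_closed[OF cones assms(2)]
  let ?P = "Mor C (src X) (src Y) \<times>\<times> (Mor C (tgt X) (tgt Y) \<times>\<times> Mor C (cone K X) (cone K Y))"
  interpret S: comm_group "Mor C (src X) (src Y)" by (simp add: hom_comm_group)
  interpret T: comm_group "Mor C (tgt X) (tgt Y)" by (simp add: hom_comm_group)
  interpret U: comm_group "Mor C (cone K X) (cone K Y)" by (simp add: hom_comm_group)
  interpret TU: group "Mor C (tgt X) (tgt Y) \<times>\<times> Mor C (cone K X) (cone K Y)"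
    by (rule DirProd_group) unfold_locales
  interpret P: group ?P by (rule DirProd_group) unfold_locales
  have inv: "inv\<^bsub>?P\<^esub> (x, y, z) = (inv\<^bsub>Mor C (src X) (src Y)\<^esub> x, inv\<^bsub>Mor C (tgt X) (tgt Y)\<^esub> y,
       inv\<^bsub>Mor C (cone K X) (cone K Y)\<^esub> z)"
    if "x \<in> hom_set C (src X) (src Y)" "y \<in> hom_set C (tgt X) (tgt Y)"
      "z \<in> hom_set C (cone K X) (cone K Y)" for x y z
    using that by (simp add: inv_DirProd S.group_axioms T.group_axioms U.group_axioms TU.group_axioms)
  have "subgroup (hom_set (Triangles0 C id_functor K) X Y) ?P"
  proof (rule P.subgroupI)
    have "(zero_mor C (src X) (src Y), zero_mor C (tgt X) (tgt Y), zero_mor C (cone K X) (cone K Y))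
      \<in> hom_set (Triangles0 C id_functor K) X Y" by simp
    then show "hom_set (Triangles0 C id_functor K) X Y \<noteq> {}" by blast
    show "hom_set (Triangles0 C id_functor K) X Y \<subseteq> carrier ?P" by auto
    fix f assume "f \<in> hom_set (Triangles0 C id_functor K) X Y"
    then show "inv\<^bsub>?P\<^esub> f \<in> hom_set (Triangles0 C id_functor K) X Y"
      by (cases f) (auto simp: inv cmp_neg_left cmp_neg_right)
    fix g assume "g \<in> hom_set (Triangles0 C id_functor K) X Y"
    with \<open>f \<in> _\<close> show "f \<otimes>\<^bsub>?P\<^esub> g \<in> hom_set (Triangles0 C id_functor K) X Y"
      by (cases f; cases g) (auto simp: cmp_add_left cmp_add_right)
  qed
  moreover have "Mor (Triangles0 C id_functor K) X Y
      = ?P\<lparr>carrier := hom_set (Triangles0 C id_functor K) X Y\<rparr>"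
    by (simp add: Triangles0_def)
  ultimately show ?thesis
    using P.m_inv_consistent[OF _ assms(3)] inv assms(3) by simp
qed

text \<open>Well-definedness of \<theta>: u' f' = 0 and f[1] v = 0 annihilate the indeterminacy, so
  x \<mapsto> u' x v is constant on a coset and \<open>the_elem\<close> returns that value.\<close>

lemma theta_coset:
  assumes "X \<in> Ob (arrow_category C)" "Y \<in> Ob (arrow_category C)" "x \<in> hom_set C (src X) (tgt Y)"
  shows "theta C id_functor K X Y (Toda_indeterminacy C id_functor X Y #>\<^bsub>Mor C (src X) (tgt Y)\<^esub> x)
    = cmp C (cone K X) (tgt Y) (cone K Y) (cone_in K Y) (cmp C (cone K X) (src X) (tgt Y) x (cone_out K X))"
proof -
  note [simp] = assms(1)[simplified] assms(2)[simplified] assms(3)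
    cone_closed[OF cones assms(1)] cone_closed[OF cones assms(2)]
  let ?F = "\<lambda>x. cmp C (cone K X) (tgt Y) (cone K Y) (cone_in K Y)
    (cmp C (cone K X) (src X) (tgt Y) x (cone_out K X))"
  let ?I = "Toda_indeterminacy C id_functor X Y"
  have F_add: "?F (y \<otimes>\<^bsub>Mor C (src X) (tgt Y)\<^esub> z) = ?F y \<otimes>\<^bsub>Mor C (cone K X) (cone K Y)\<^esub> ?F z"
    if "y \<in> hom_set C (src X) (tgt Y)" "z \<in> hom_set C (src X) (tgt Y)" for y z
    using that by (simp add: cmp_add_left cmp_add_right cmp_closed)
  have F_I: "?F y = zero_mor C (cone K X) (cone K Y)" if yI: "y \<in> ?I" for y
  proof -
    obtain g h where gh [simp]: "g \<in> hom_set C (src X) (src Y)" "h \<in> hom_set C (tgt X) (tgt Y)" and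
      y: "y = cmp C (src X) (src Y) (tgt Y) (arr Y) g \<otimes>\<^bsub>Mor C (src X) (tgt Y)\<^esub>
        inv\<^bsub>Mor C (src X) (tgt Y)\<^esub> cmp C (src X) (tgt X) (tgt Y) h (arr X)"
      using yI by (auto simp: Toda_indeterminacy_def)
    have "?F (cmp C (src X) (src Y) (tgt Y) (arr Y) g)
      = cmp C (cone K X) (src Y) (cone K Y) (cmp C (src Y) (tgt Y) (cone K Y) (cone_in K Y) (arr Y))
          (cmp C (cone K X) (src X) (src Y) g (cone_out K X))"
      by (simp add: cmp_assoc cmp_closed)
    moreover have "cmp C (cone K X) (src X) (tgt Y) (cmp C (src X) (tgt X) (tgt Y) h (arr X)) (cone_out K X)
      = cmp C (cone K X) (tgt X) (tgt Y) h (cmp C (cone K X) (src X) (tgt X) (arr X) (cone_out K X))"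
      by (simp add: cmp_assoc cmp_closed)
    ultimately show ?thesis
      using cmp12_zero[OF cone_triangle[OF cones assms(2)]] cmp31_zero[OF cone_triangle[OF cones assms(1)]]
      by (simp add: y F_add cmp_closed cmp_neg_left cmp_neg_right)
  qed
  have I: "subgroup ?I (Mor C (src X) (tgt Y))" by (rule Toda_indeterminacy_subgroup[OF assms(1,2)])
  have sub: "y \<in> hom_set C (src X) (tgt Y)" if "y \<in> ?I" for y
    using subgroup.subset[OF I] that by blast
  have "?F ` (?I #>\<^bsub>Mor C (src X) (tgt Y)\<^esub> x) = {?F x}"
  proof (intro equalityI subsetI)
    fix z assume "z \<in> ?F ` (?I #>\<^bsub>Mor C (src X) (tgt Y)\<^esub> x)"
    then obtain y where "y \<in> ?I" "z = ?F (y \<otimes>\<^bsub>Mor C (src X) (tgt Y)\<^esub> x)"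
      by (auto simp: r_coset_def)
    then show "z \<in> {?F x}" by (simp add: F_add sub F_I cmp_closed)
  next
    fix z assume "z \<in> {?F x}"
    then have "z = ?F (zero_mor C (src X) (tgt Y) \<otimes>\<^bsub>Mor C (src X) (tgt Y)\<^esub> x)" by simp
    then show "z \<in> ?F ` (?I #>\<^bsub>Mor C (src X) (tgt Y)\<^esub> x)"
      using subgroup.one_closed[OF I] unfolding r_coset_def by blast
  qed
  then show ?thesis by (simp add: theta_def)
qed

lemma Toda_bval_coset:
  assumes "\<xi> \<in> carrier (bval (Toda C id_functor) X Y)"
  obtains x where "x \<in> hom_set C (src X) (tgt Y)"
    "\<xi> = Toda_indeterminacy C id_functor X Y #>\<^bsub>Mor C (src X) (tgt Y)\<^esub> x"
  using assms by (auto simp: Toda_def carrier_FactGroup)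

text \<open>Both conditions defining \<Theta> follow from v u = 0 for the two cones.\<close>

lemma theta_closed:
  assumes "X \<in> Ob (arrow_category C)" "Y \<in> Ob (arrow_category C)"
    "\<xi> \<in> carrier (bval (Toda C id_functor) X Y)"
  shows "theta C id_functor K X Y \<xi> \<in> carrier (bval (Theta C id_functor K) X Y)"
proof -
  note tX = cone_triangle[OF cones assms(1)] and tY = cone_triangle[OF cones assms(2)]
  note [simp] = triangleD[OF tX] triangleD[OF tY]
  obtain x where [simp]: "x \<in> hom_set C (src X) (tgt Y)" and
    \<xi>: "\<xi> = Toda_indeterminacy C id_functor X Y #>\<^bsub>Mor C (src X) (tgt Y)\<^esub> x"
    using Toda_bval_coset[OF assms(3)] .
  have 1: "cmp C (tgt X) (cone K X) (src X) (cone_out K X) (cone_in K X) = zero_mor C (tgt X) (src X)"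
    using cmp12_zero[OF rotate[OF tX]] .
  have 2: "cmp C (tgt Y) (cone K Y) (src Y) (cone_out K Y) (cone_in K Y) = zero_mor C (tgt Y) (src Y)"
    using cmp12_zero[OF rotate[OF tY]] .
  let ?xv = "cmp C (cone K X) (src X) (tgt Y) x (cone_out K X)"
  have "cmp C (cone K X) (cone K Y) (src Y) (cone_out K Y) (cmp C (cone K X) (tgt Y) (cone K Y) (cone_in K Y) ?xv)
    = cmp C (cone K X) (tgt Y) (src Y) (cmp C (tgt Y) (cone K Y) (src Y) (cone_out K Y) (cone_in K Y)) ?xv"
    by (rule cmp_assoc[symmetric]) (simp_all add: cmp_closed)
  then show ?thesis
    by (simp add: \<xi> theta_coset[OF assms(1,2)] Theta_def cmp_closed cmp_assoc 1 2)
qed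

text \<open>Common interface of the two formulations: any set-theoretic section \<open>s\<close> of
  \<pi> whose failure to be multiplicative lies in the image of \<theta>. Its third components form
  the \<sigma> of \<open>lift_modulo_theta\<close>.\<close>

lemma double_ide_eq_zero_of_lift_modulo_theta:
  assumes A: "A \<in> Ob C"
    and tri: "(A, A, A, double_ide A, double_ide A, double_ide A) \<in> \<D>"
    and four: "double_ide A \<otimes>\<^bsub>Mor C A A\<^esub> double_ide A = zero_mor C A A"
    and lift: "\<And>X Y f. (X, Y, f) \<in> strings1 (arrow_category C) \<Longrightarrow>
      s (X, Y, f) \<in> hom_set (Triangles0 C id_functor K) X Y \<and> fmor Triangles0_proj X Y (s (X, Y, f)) = f"
    and cmp: "\<And>X Y Z f g. (X, Y, Z, f, g) \<in> strings2 (arrow_category C) \<Longrightarrow>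
      \<exists>\<xi>\<in>carrier (bval (Toda C id_functor) X Z).
        cmp (Triangles0 C id_functor K) X Y Z (s (Y, Z, g)) (s (X, Y, f))
        = Theta_incl C X Z (theta C id_functor K X Z \<xi>) \<otimes>\<^bsub>Mor (Triangles0 C id_functor K) X Z\<^esub>
          s (X, Z, cmp (arrow_category C) X Y Z g f)"
  shows "double_ide A = zero_mor C A A"
proof -
  define \<sigma> where "\<sigma> = (\<lambda>X Y a b. snd (snd (s (X, Y, (a, b)))))"
  have s: "s (X, Y, (a, b)) = (a, b, \<sigma> X Y a b)"
    if "X \<in> Ob (arrow_category C)" "Y \<in> Ob (arrow_category C)"
      "(a, b) \<in> hom_set (arrow_category C) X Y" for X Y a b
    using lift[of X Y "(a, b)"] that by (cases "s (X, Y, (a, b))") (simp add: \<sigma>_def)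
  have l: "(a, b, \<sigma> X Y a b) \<in> hom_set (Triangles0 C id_functor K) X Y"
    if "X \<in> Ob (arrow_category C)" "Y \<in> Ob (arrow_category C)"
      "(a, b) \<in> hom_set (arrow_category C) X Y" for X Y a b
    using lift[of X Y "(a, b)"] that s[OF that] by simp
  have "lift_modulo_theta C \<D> K \<sigma>"
  proof unfold_locales
    fix X Y Z a b a' b'
    assume h: "X \<in> Ob (arrow_category C)" "Y \<in> Ob (arrow_category C)" "Z \<in> Ob (arrow_category C)"
      "(a, b) \<in> hom_set (arrow_category C) X Y" "(a', b') \<in> hom_set (arrow_category C) Y Z"
    have gf: "(cmp C (src X) (src Y) (src Z) a' a, cmp C (tgt X) (tgt Y) (tgt Z) b' b)
        \<in> hom_set (arrow_category C) X Z"
      using arrow_category_cmp_closed[OF h] by simp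
    note [simp] = cone_closed[OF cones h(1)] cone_closed[OF cones h(3)]
    interpret U: comm_group "Mor C (cone K X) (cone K Z)" by (simp add: hom_comm_group)
    obtain \<xi> where \<xi>: "\<xi> \<in> carrier (bval (Toda C id_functor) X Z)" and
      "cmp (Triangles0 C id_functor K) X Y Z (s (Y, Z, (a', b'))) (s (X, Y, (a, b)))
        = Theta_incl C X Z (theta C id_functor K X Z \<xi>) \<otimes>\<^bsub>Mor (Triangles0 C id_functor K) X Z\<^esub>
          s (X, Z, cmp (arrow_category C) X Y Z (a', b') (a, b))"
      using cmp[of X Y Z "(a, b)" "(a', b')"] h by auto
    then have eq: "cmp C (cone K X) (cone K Y) (cone K Z) (\<sigma> Y Z a' b') (\<sigma> X Y a b)
      = theta C id_functor K X Z \<xi> \<otimes>\<^bsub>Mor C (cone K X) (cone K Z)\<^esub>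
        \<sigma> X Z (cmp C (src X) (src Y) (src Z) a' a) (cmp C (tgt X) (tgt Y) (tgt Z) b' b)"
      unfolding arrow_category_cmp s[OF h(1,2,4)] s[OF h(2,3,5)] s[OF h(1,3) gf]
      by (simp add: Theta_incl_def)
    obtain x where x: "x \<in> hom_set C (src X) (tgt Z)" and
      \<xi>x: "\<xi> = Toda_indeterminacy C id_functor X Z #>\<^bsub>Mor C (src X) (tgt Z)\<^esub> x"
      using Toda_bval_coset[OF \<xi>] .
    have "\<sigma> X Z (cmp C (src X) (src Y) (src Z) a' a) (cmp C (tgt X) (tgt Y) (tgt Z) b' b)
      \<in> hom_set C (cone K X) (cone K Z)"
      using l[OF h(1,3) gf] by simp
    then show "\<exists>x\<in>hom_set C (src X) (tgt Z).
          cmp C (cone K X) (cone K Y) (cone K Z) (\<sigma> Y Z a' b') (\<sigma> X Y a b)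
          = \<sigma> X Z (cmp C (src X) (src Y) (src Z) a' a) (cmp C (tgt X) (tgt Y) (tgt Z) b' b)
            \<otimes>\<^bsub>Mor C (cone K X) (cone K Z)\<^esub>
            cmp C (cone K X) (tgt Z) (cone K Z) (cone_in K Z)
              (cmp C (cone K X) (src X) (tgt Z) x (cone_out K X))"
      using x unfolding eq \<xi>x theta_coset[OF h(1,3) x]
      by (intro bexI[of _ x]) (simp_all add: U.m_comm cmp_closed)
  qed (use cones l in auto)
  then show ?thesis by (rule lift_modulo_theta.double_ide_eq_zero[OF _ A tri four])
qed

end

section \<open>Nonexistence for cohomology classes and for extensions\<close>

context
  fixes K :: "('o, 'm) cones" and A :: 'o
  assumes cones: "cone_choice C \<D> K"
    and A: "A \<in> Ob C"
    and tri: "(A, A, A, double_ide A, double_ide A, double_ide A) \<in> \<D>"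
    and four: "double_ide A \<otimes>\<^bsub>Mor C A A\<^esub> double_ide A = zero_mor C A A"
    and two: "double_ide A \<noteq> zero_mor C A A"
begin

text \<open>If the class were \<theta> applied to a class of \<Delta>, it would contain some
  \<theta> c. Its elements are the cocycles of sections, so some section has cocycle exactly
  \<theta> c and multiplies up to values of \<theta>.\<close>

lemma extension_class_notin_theta_image:
  "extension_class (arrow_category C) (Theta C id_functor K)
     (Triangles0 C id_functor K) Triangles0_proj (Theta_incl C)
   \<notin> HH2_map (arrow_category C) (Theta C id_functor K) (theta C id_functor K)
       ` carrier (HH2 (arrow_category C) (Toda C id_functor))"
proof
  let ?B = "arrow_category C" and ?T = "Triangles0 C id_functor K"
    and ?\<Theta> = "Theta C id_functor K" and ?\<theta> = "theta C id_functor K"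
  assume "extension_class ?B ?\<Theta> ?T Triangles0_proj (Theta_incl C)
    \<in> HH2_map ?B ?\<Theta> ?\<theta> ` carrier (HH2 ?B (Toda C id_functor))"
  then obtain \<eta> where \<eta>: "\<eta> \<in> carrier (HH2 ?B (Toda C id_functor))" and
    cls: "extension_class ?B ?\<Theta> ?T Triangles0_proj (Theta_incl C) = HH2_map ?B ?\<Theta> ?\<theta> \<eta>"
    by auto
  obtain c where c: "c \<in> carrier (cochains2 ?B (Toda C id_functor))" and
    "restrict (\<lambda>(X, Y, Z, f, g). ?\<theta> X Z (c (X, Y, Z, f, g))) (strings2 ?B) \<in> HH2_map ?B ?\<Theta> ?\<theta> \<eta>"
  proof (rule HH2_map_representative[OF Toda_bval_group Theta_bval_group[OF cones] theta_closed[OF cones] _ _ \<eta>])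
    show "\<one>\<^bsub>cochains2 ?B (Toda C id_functor)\<^esub> \<in> coboundaries2 ?B (Toda C id_functor)"
      by (rule one_in_coboundaries2)
        (fact Toda_bval_group arrow_category_cmp_closed Toda_post_one Toda_pre_one)+
    show "\<one>\<^bsub>cochains2 ?B ?\<Theta>\<^esub> \<in> coboundaries2 ?B ?\<Theta>"
      by (rule one_in_coboundaries2)
        (fact Theta_bval_group[OF cones] arrow_category_cmp_closed Theta_post_one[OF cones]
          Theta_pre_one[OF cones])+
  qed
  then obtain s where s: "s \<in> sections ?B ?T Triangles0_proj" and
    sc: "section_cocycle ?B ?\<Theta> ?T Triangles0_proj (Theta_incl C) s
      = restrict (\<lambda>(X, Y, Z, f, g). ?\<theta> X Z (c (X, Y, Z, f, g))) (strings2 ?B)"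
    unfolding cls[symmetric] extension_class_def by auto
  \<comment> \<open>\<pi> is the identity on objects, so the inverse used by \<open>sections\<close>
    is the identity as well.\<close>
  have G: "inv_into (Ob ?B) (fob Triangles0_proj) X = X" if "X \<in> Ob ?B" for X
    using that inv_into_f_f[of "fob Triangles0_proj" "Ob ?B" X]
    by (simp add: inj_on_def del: arrow_category_Ob)
  have lift: "s (X, Y, f) \<in> hom_set ?T X Y \<and> fmor Triangles0_proj X Y (s (X, Y, f)) = f"
    if "(X, Y, f) \<in> strings1 ?B" for X Y f
    using PiE_mem[OF s[unfolded sections_def Let_def] that] that by (simp add: G del: arrow_category_Ob)
  have "double_ide A = zero_mor C A A"
  proof (rule double_ide_eq_zero_of_lift_modulo_theta[OF cones A tri four lift])
    fix X Y Z f g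
    assume str: "(X, Y, Z, f, g) \<in> strings2 ?B"
    then have ob: "X \<in> Ob ?B" "Y \<in> Ob ?B" "Z \<in> Ob ?B" and
      fg: "f \<in> hom_set ?B X Y" "g \<in> hom_set ?B Y Z"
      by (simp_all del: arrow_category_Ob)
    note gf = arrow_category_cmp_closed[OF ob fg]
    note cone [simp] = cone_closed[OF cones ob(1)] cone_closed[OF cones ob(2)] cone_closed[OF cones ob(3)]
    obtain a b a' b' where ab: "f = (a, b)" "g = (a', b')" by (cases f; cases g) auto
    obtain p where p: "s (X, Y, f) = (a, b, p)"
      using lift[of X Y f] ob fg by (cases "s (X, Y, f)") (simp add: ab)
    obtain q where q: "s (Y, Z, g) = (a', b', q)"
      using lift[of Y Z g] ob fg by (cases "s (Y, Z, g)") (simp add: ab)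
    let ?a = "cmp C (src X) (src Y) (src Z) a' a" and ?b = "cmp C (tgt X) (tgt Y) (tgt Z) b' b"
    obtain r where r: "s (X, Z, cmp ?B X Y Z g f) = (?a, ?b, r)"
      using lift[of X Z "cmp ?B X Y Z g f"] ob gf by (cases "s (X, Z, cmp ?B X Y Z g f)") (simp add: ab)
    let ?qp = "cmp C (cone K X) (cone K Y) (cone K Z) q p"
    have P: "(a, b, p) \<in> hom_set ?T X Y" and Q: "(a', b', q) \<in> hom_set ?T Y Z"
      and R: "(?a, ?b, r) \<in> hom_set ?T X Z"
      using lift[of X Y f] lift[of Y Z g] lift[of X Z "cmp ?B X Y Z g f"] ob fg gf by (simp_all add: p q r)
    have QP: "(?a, ?b, ?qp) \<in> hom_set ?T X Z"
      using Triangles0_cmp_closed[OF cones ob P Q] by simp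
    interpret U: comm_group "Mor C (cone K X) (cone K Z)" by (simp add: hom_comm_group)
    interpret S: comm_group "Mor C (src X) (src Z)" by (simp add: hom_comm_group)
    interpret T: comm_group "Mor C (tgt X) (tgt Z)" by (simp add: hom_comm_group)
    interpret UX: comm_group "Mor C (tgt X) (cone K Z)" by (simp add: hom_comm_group)
    interpret UZ: comm_group "Mor C (cone K X) (src Z)" by (simp add: hom_comm_group)
    have [simp]: "r \<in> hom_set C (cone K X) (cone K Z)" "?qp \<in> hom_set C (cone K X) (cone K Z)"
      "?a \<in> hom_set C (src X) (src Z)" "?b \<in> hom_set C (tgt X) (tgt Z)"
      using R QP by simp_all
    define w where "w = ?qp \<otimes>\<^bsub>Mor C (cone K X) (cone K Z)\<^esub> inv\<^bsub>Mor C (cone K X) (cone K Z)\<^esub> r"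
    \<comment> \<open>\<open>?qp\<close> and \<open>r\<close> complete the same pair (a' a, b' b) to
      a morphism of triangles, so their difference satisfies both equations of \<Theta>; hence
      \<open>inv_into\<close> in the section cocycle recovers it.\<close>
    have w: "w \<in> carrier (bval ?\<Theta> X Z)"
      using R QP by (simp add: w_def Theta_def cmp_add_left cmp_add_right cmp_neg_left cmp_neg_right cmp_closed)
    have incl: "cmp ?T X Y Z (s (Y, Z, g)) (s (X, Y, f)) \<otimes>\<^bsub>Mor ?T X Z\<^esub>
        inv\<^bsub>Mor ?T X Z\<^esub> s (X, Z, cmp ?B X Y Z g f) = Theta_incl C X Z w"
      unfolding p q r Triangles0_inv[OF cones ob(1,3) R] by (simp add: Theta_incl_def w_def)
    have inj: "inj_on (Theta_incl C X Z) (carrier (bval ?\<Theta> X Z))"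
      by (simp add: Theta_incl_def inj_on_def)
    have "?\<theta> X Z (c (X, Y, Z, f, g))
      = section_cocycle ?B ?\<Theta> ?T Triangles0_proj (Theta_incl C) s (X, Y, Z, f, g)"
      using str by (simp add: sc del: strings2_iff)
    also have "\<dots> = inv_into (carrier (bval ?\<Theta> X Z)) (Theta_incl C X Z) (Theta_incl C X Z w)"
      using str unfolding incl[symmetric] by (simp add: section_cocycle_def Let_def G ob del: arrow_category_Ob strings2_iff)
    also have "\<dots> = w" by (rule inv_into_f_f[OF inj w])
    finally have \<theta>w: "?\<theta> X Z (c (X, Y, Z, f, g)) = w" .
    have "w \<otimes>\<^bsub>Mor C (cone K X) (cone K Z)\<^esub> r = ?qp"
      by (simp add: w_def U.m_assoc)
    then have "cmp ?T X Y Z (s (Y, Z, g)) (s (X, Y, f))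
        = Theta_incl C X Z (?\<theta> X Z (c (X, Y, Z, f, g))) \<otimes>\<^bsub>Mor ?T X Z\<^esub> s (X, Z, cmp ?B X Y Z g f)"
      unfolding \<theta>w by (simp only: p q r) (simp add: Theta_incl_def)
    moreover have "c (X, Y, Z, f, g) \<in> carrier (bval (Toda C id_functor) X Z)"
      using PiE_mem[OF c[unfolded cochains2_def carrier_product_group] str] by simp
    ultimately show "\<exists>\<xi>\<in>carrier (bval (Toda C id_functor) X Z).
        cmp ?T X Y Z (s (Y, Z, g)) (s (X, Y, f))
        = Theta_incl C X Z (?\<theta> X Z \<xi>) \<otimes>\<^bsub>Mor ?T X Z\<^esub> s (X, Z, cmp ?B X Y Z g f)"
      by blast
  qed
  with two show False by simp
qed

text \<open>An arbitrary set-theoretic section q of p gives the section T q of \<pi>. The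
  multiplicative defect of q lies in the kernel of p, which is the image of i, and T turns i into
  \<theta>.\<close>

lemma no_extension_morphism_along_theta:
  fixes E :: "('e, 'f) category"
  assumes "singular_extension (arrow_category C) (Toda C id_functor) E p i"
    and "extension_morphism (Toda C id_functor) (theta C id_functor K) E p i
      (Triangles0 C id_functor K) Triangles0_proj (Theta_incl C) T"
  shows False
proof -
  let ?B = "arrow_category C" and ?T = "Triangles0 C id_functor K" and ?\<theta> = "theta C id_functor K"
  interpret ext: singular_extension ?B "Toda C id_functor" E p i by (rule assms)
  interpret T: additive_functor E ?T T
    using assms(2) by (simp add: extension_morphism_def)
  have Tp: "functor_eq E (comp_functor Triangles0_proj T) p" and
    Ti: "\<And>X Y d. \<lbrakk>X \<in> Ob E; Y \<in> Ob E; d \<in> carrier (bval (Toda C id_functor) (fob p X) (fob p Y))\<rbrakk>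
      \<Longrightarrow> fmor T X Y (i X Y d) = Theta_incl C (fob T X) (fob T Y) (?\<theta> (fob p X) (fob p Y) d)"
    using assms(2) by (auto simp: extension_morphism_def)
  define G where "G = inv_into (Ob E) (fob p)"
  have G [simp]: "G X \<in> Ob E" "fob p (G X) = X" if "X \<in> Ob ?B" for X
    using that ext.quotient_ob unfolding G_def
    by (auto simp: bij_betw_def inv_into_into f_inv_into_f simp del: arrow_category_Ob)
  have TG [simp]: "fob T (G X) = X" if "X \<in> Ob ?B" for X
    using Tp that G[OF that] by (auto simp: functor_eq_def comp_functor_def simp del: arrow_category_Ob)
  \<comment> \<open>Fullness of p: by \<open>quotient_mor\<close> f is the value on some coset of
    the kernel, and p is constant on that coset.\<close>
  have "\<exists>m\<in>hom_set E (G X) (G Y). fmor p (G X) (G Y) m = f"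
    if XY: "X \<in> Ob ?B" "Y \<in> Ob ?B" and f: "f \<in> hom_set ?B X Y" for X Y f
  proof -
    let ?ker = "functor_kernel E ?B p (G X) (G Y)"
    have "group_hom (Mor E (G X) (G Y)) (Mor ?B X Y) (fmor p (G X) (G Y))"
      using ext.F.fmor_hom[of "G X" "G Y"] XY ext.A.hom_group ext.B.hom_group
      by (simp add: group_hom_def group_hom_axioms_def del: arrow_category_Ob)
    then interpret h: group_hom "Mor E (G X) (G Y)" "Mor ?B X Y" "fmor p (G X) (G Y)" .
    have "f \<in> (\<lambda>\<xi>. the_elem (fmor p (G X) (G Y) ` \<xi>)) ` carrier (Mor E (G X) (G Y) Mod ?ker)"
      using ext.quotient_mor[of "G X" "G Y"] XY f
      by (simp add: iso_def bij_betw_def del: arrow_category_Ob)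
    then obtain m where m: "m \<in> hom_set E (G X) (G Y)"
      and f': "f = the_elem (fmor p (G X) (G Y) ` (?ker #>\<^bsub>Mor E (G X) (G Y)\<^esub> m))"
      by (auto simp: carrier_FactGroup)
    have "\<one>\<^bsub>Mor E (G X) (G Y)\<^esub> \<in> ?ker"
      using XY by (simp add: functor_kernel_def kernel_def del: arrow_category_Ob)
    then have "fmor p (G X) (G Y) ` (?ker #>\<^bsub>Mor E (G X) (G Y)\<^esub> m) = {fmor p (G X) (G Y) m}"
      using m XY by (auto simp: functor_kernel_def kernel_def r_coset_def image_iff
        simp del: arrow_category_Ob intro!: exI[of _ "\<one>\<^bsub>Mor E (G X) (G Y)\<^esub>"])
    then show ?thesis using m f' by auto
  qed
  then obtain q where q: "\<And>X Y f. \<lbrakk>X \<in> Ob ?B; Y \<in> Ob ?B; f \<in> hom_set ?B X Y\<rbrakk> \<Longrightarrow>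
    q X Y f \<in> hom_set E (G X) (G Y) \<and> fmor p (G X) (G Y) (q X Y f) = f"
    by metis
  define s where "s = (\<lambda>(X, Y, f). fmor T (G X) (G Y) (q X Y f))"
  have T_hom: "fmor T (G X) (G Y) m \<in> hom_set ?T X Y"
    if "X \<in> Ob ?B" "Y \<in> Ob ?B" "m \<in> hom_set E (G X) (G Y)" for X Y m
    using T.fmor_hom[of "G X" "G Y"] that by (auto simp: hom_def simp del: arrow_category_Ob)
  have proj: "fmor Triangles0_proj X Y (fmor T (G X) (G Y) m) = fmor p (G X) (G Y) m"
    if "X \<in> Ob ?B" "Y \<in> Ob ?B" "m \<in> hom_set E (G X) (G Y)" for X Y m
  proof -
    have "fmor (comp_functor Triangles0_proj T) (G X) (G Y) m = fmor p (G X) (G Y) m"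
      using Tp that G(1) unfolding functor_eq_def by blast
    then show ?thesis using that by (simp add: comp_functor_def del: arrow_category_Ob)
  qed
  have lift: "s (X, Y, f) \<in> hom_set ?T X Y \<and> fmor Triangles0_proj X Y (s (X, Y, f)) = f"
    if "(X, Y, f) \<in> strings1 ?B" for X Y f
    using that q[of X Y f] T_hom[of X Y "q X Y f"] proj[of X Y "q X Y f"]
    by (simp add: s_def del: arrow_category_Ob)
  have "double_ide A = zero_mor C A A"
  proof (rule double_ide_eq_zero_of_lift_modulo_theta[OF cones A tri four lift])
    fix X Y Z f g
    assume "(X, Y, Z, f, g) \<in> strings2 ?B"
    then have ob: "X \<in> Ob ?B" "Y \<in> Ob ?B" "Z \<in> Ob ?B" and
      fg: "f \<in> hom_set ?B X Y" "g \<in> hom_set ?B Y Z"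
      by (simp_all del: arrow_category_Ob)
    note gf = arrow_category_cmp_closed[OF ob fg]
    note [simp del] = arrow_category_Ob
    note [simp] = ob fg gf
    let ?gf = "cmp ?B X Y Z g f"
    let ?qq = "cmp E (G X) (G Y) (G Z) (q Y Z g) (q X Y f)"
    have qs [simp]: "q X Y f \<in> hom_set E (G X) (G Y)" "q Y Z g \<in> hom_set E (G Y) (G Z)"
      "q X Z ?gf \<in> hom_set E (G X) (G Z)"
      "fmor p (G X) (G Y) (q X Y f) = f" "fmor p (G Y) (G Z) (q Y Z g) = g"
      "fmor p (G X) (G Z) (q X Z ?gf) = ?gf"
      using q by simp_all
    have qq [simp]: "?qq \<in> hom_set E (G X) (G Z)" by (simp add: ext.A.cmp_closed)
    interpret EXZ: comm_group "Mor E (G X) (G Z)" by (simp add: ext.A.hom_comm_group)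
    interpret BXZ: comm_group "Mor ?B X Z" by (simp add: ext.B.hom_comm_group)
    interpret h: group_hom "Mor E (G X) (G Z)" "Mor ?B X Z" "fmor p (G X) (G Z)"
      using ext.F.fmor_hom[of "G X" "G Z"] by unfold_locales simp
    \<comment> \<open>The defect of the section q; as an element of the kernel of p it is i \<xi>
      for some \<xi> in \<Delta>.\<close>
    define m where "m = ?qq \<otimes>\<^bsub>Mor E (G X) (G Z)\<^esub> inv\<^bsub>Mor E (G X) (G Z)\<^esub> q X Z ?gf"
    have m [simp]: "m \<in> hom_set E (G X) (G Z)" by (simp add: m_def)
    have "fmor p (G X) (G Z) ?qq = ?gf"
      using ext.F.fmor_cmp[of "G X" "G Y" "G Z" "q X Y f" "q Y Z g"] by simp
    then have "m \<in> functor_kernel E ?B p (G X) (G Z)"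
      by (simp add: functor_kernel_def kernel_def) (simp add: m_def)
    then have "m \<in> i (G X) (G Z) ` carrier (bval (Toda C id_functor) X Z)"
      using ext.incl_iso[of "G X" "G Z"] by (simp add: iso_def bij_betw_def)
    then obtain \<xi> where \<xi>: "\<xi> \<in> carrier (bval (Toda C id_functor) X Z)" and mi: "m = i (G X) (G Z) \<xi>"
      by blast
    have Tm: "fmor T (G X) (G Z) m = Theta_incl C X Z (?\<theta> X Z \<xi>)"
      using Ti[of "G X" "G Z" \<xi>] \<xi> by (simp add: mi)
    have "cmp ?T X Y Z (s (Y, Z, g)) (s (X, Y, f)) = fmor T (G X) (G Z) ?qq"
      using T.fmor_cmp[of "G X" "G Y" "G Z" "q X Y f" "q Y Z g"] by (simp add: s_def)
    also have "?qq = m \<otimes>\<^bsub>Mor E (G X) (G Z)\<^esub> q X Z ?gf"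
      by (simp add: m_def EXZ.m_assoc)
    also have "fmor T (G X) (G Z) \<dots> = fmor T (G X) (G Z) m \<otimes>\<^bsub>Mor ?T X Z\<^esub> s (X, Z, ?gf)"
      using hom_mult[OF T.fmor_hom[of "G X" "G Z"], of m "q X Z ?gf"] by (simp add: s_def)
    finally show "\<exists>\<xi>\<in>carrier (bval (Toda C id_functor) X Z).
        cmp ?T X Y Z (s (Y, Z, g)) (s (X, Y, f))
        = Theta_incl C X Z (?\<theta> X Z \<xi>) \<otimes>\<^bsub>Mor ?T X Z\<^esub> s (X, Z, ?gf)"
      using \<xi> Tm by auto
  qed
  with two show False by simp
qed

end
end

section \<open>Free modules over the integers modulo 4\<close>

lemma add_residue_ring: "x \<oplus>\<^bsub>residue_ring m\<^esub> y = (x + y) mod m"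
  by (simp add: residue_ring_def)

context
  fixes A :: "(int, 'v) module"
  assumes A: "free_of_rank (residue_ring 4) A 1"
begin

lemma free_rank1_Ob: "A \<in> Ob F_Z4"
  using A by (auto simp: free_modules_def)

lemma ide_add_ide_eq_scalar_map: "ide F_Z4 A \<otimes>\<^bsub>Mor F_Z4 A A\<^esub> ide F_Z4 A = scalar_map A 2"
proof -
  interpret M: module "residue_ring 4" A using A by (simp add: free_of_rank_def)
  have "x \<oplus>\<^bsub>A\<^esub> x = 2 \<odot>\<^bsub>A\<^esub> x" if "x \<in> carrier A" for x
  proof -
    have "(1 \<oplus>\<^bsub>residue_ring 4\<^esub> 1) \<odot>\<^bsub>A\<^esub> x = 1 \<odot>\<^bsub>A\<^esub> x \<oplus>\<^bsub>A\<^esub> 1 \<odot>\<^bsub>A\<^esub> x"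
      by (rule M.smult_l_distr) (use that in \<open>simp_all add: residue_ring_def\<close>)
    moreover have "1 \<odot>\<^bsub>A\<^esub> x = x"
      using M.smult_one[OF that] by (simp add: residue_ring_def)
    ultimately show ?thesis by (simp add: add_residue_ring)
  qed
  then show ?thesis
    by (auto simp: free_modules_def scalar_map_def fun_eq_iff restrict_def)
qed

lemma scalar_map_2_add_self: "scalar_map A 2 \<otimes>\<^bsub>Mor F_Z4 A A\<^esub> scalar_map A 2 = zero_mor F_Z4 A A"
proof -
  interpret M: module "residue_ring 4" A using A by (simp add: free_of_rank_def)
  have "2 \<odot>\<^bsub>A\<^esub> x \<oplus>\<^bsub>A\<^esub> 2 \<odot>\<^bsub>A\<^esub> x = \<zero>\<^bsub>A\<^esub>" if "x \<in> carrier A" for x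
  proof -
    have "(2 \<oplus>\<^bsub>residue_ring 4\<^esub> 2) \<odot>\<^bsub>A\<^esub> x = 2 \<odot>\<^bsub>A\<^esub> x \<oplus>\<^bsub>A\<^esub> 2 \<odot>\<^bsub>A\<^esub> x"
      by (rule M.smult_l_distr) (use that in \<open>simp_all add: residue_ring_def\<close>)
    moreover have "0 \<odot>\<^bsub>A\<^esub> x = \<zero>\<^bsub>A\<^esub>"
      using M.smult_l_null[OF that] by (simp add: residue_ring_def)
    ultimately show ?thesis by (simp add: add_residue_ring)
  qed
  then show ?thesis
    by (auto simp: free_modules_def scalar_map_def fun_eq_iff restrict_def)
qed

text \<open>If 2 annihilated the basis vector, 0 would have the two distinct coordinates 2 and 0,
  against uniqueness of coordinates.\<close>

lemma scalar_map_2_neq_zero: "scalar_map A 2 \<noteq> zero_mor F_Z4 A A"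
proof
  assume eq: "scalar_map A 2 = zero_mor F_Z4 A A"
  interpret M: module "residue_ring 4" A using A by (simp add: free_of_rank_def)
  obtain b where "b \<in> {..<1::nat} \<rightarrow> carrier A" and
    uniq: "\<forall>x\<in>carrier A. \<exists>!a. a \<in> {..<1::nat} \<rightarrow>\<^sub>E carrier (residue_ring 4) \<and>
        x = (\<Oplus>\<^bsub>A\<^esub>j\<in>{..<1}. a j \<odot>\<^bsub>A\<^esub> b j)"
    using A unfolding free_of_rank_def by blast
  then have b: "b 0 \<in> carrier A" by auto
  have sum: "(\<Oplus>\<^bsub>A\<^esub>j\<in>{..<1::nat}. a j \<odot>\<^bsub>A\<^esub> b j) = a 0 \<odot>\<^bsub>A\<^esub> b 0" if "a 0 \<in> carrier (residue_ring 4)" for a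
  proof -
    have "{..<1::nat} = {0}" by auto
    then show ?thesis using that b by (simp add: M.M.finsum_insert)
  qed
  have c: "0 \<in> carrier (residue_ring 4)" "2 \<in> carrier (residue_ring 4)"
    by (simp_all add: residue_ring_def)
  have z2: "2 \<odot>\<^bsub>A\<^esub> b 0 = \<zero>\<^bsub>A\<^esub>"
    using fun_cong[OF eq, of "b 0"] b by (simp add: scalar_map_def free_modules_def)
  have z0: "0 \<odot>\<^bsub>A\<^esub> b 0 = \<zero>\<^bsub>A\<^esub>"
    using M.smult_l_null[OF b] by (simp add: residue_ring_def)
  have coeff: "(\<lambda>j\<in>{..<1::nat}. r) \<in> {..<1} \<rightarrow>\<^sub>E carrier (residue_ring 4) \<and>
      \<zero>\<^bsub>A\<^esub> = (\<Oplus>\<^bsub>A\<^esub>j\<in>{..<1}. (\<lambda>j\<in>{..<1::nat}. r) j \<odot>\<^bsub>A\<^esub> b j)"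
    if "r \<in> carrier (residue_ring 4)" "r \<odot>\<^bsub>A\<^esub> b 0 = \<zero>\<^bsub>A\<^esub>" for r
  proof
    show "(\<lambda>j\<in>{..<1::nat}. r) \<in> {..<1} \<rightarrow>\<^sub>E carrier (residue_ring 4)" using that(1) by auto
    have "(\<lambda>j\<in>{..<1::nat}. r) 0 = r" by simp
    then show "\<zero>\<^bsub>A\<^esub> = (\<Oplus>\<^bsub>A\<^esub>j\<in>{..<1}. (\<lambda>j\<in>{..<1::nat}. r) j \<odot>\<^bsub>A\<^esub> b j)"
      using sum[of "\<lambda>j\<in>{..<1}. r"] that by presburger
  qed
  note ex1 = bspec[OF uniq M.M.zero_closed]
  have "(\<lambda>j\<in>{..<1::nat}. 2) = (\<lambda>j\<in>{..<1::nat}. 0::int)"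
    using the1_equality[OF ex1, OF coeff[OF c(2) z2]] the1_equality[OF ex1, OF coeff[OF c(1) z0]]
    by (rule trans[OF sym])
  from fun_cong[OF this, of 0] show False by simp
qed

end

theorem mainTheorem5:
  fixes \<D> :: "((int, 'v::infinite) module, 'v \<Rightarrow> 'v) triangle set"
    and K :: "((int, 'v) module, 'v \<Rightarrow> 'v) cones"
    and A :: "(int, 'v) module"
  assumes "triangulated_category F_Z4 id_functor \<D>"
    and "free_of_rank (residue_ring 4) A 1"
    and "(A, A, A, scalar_map A 2, scalar_map A 2, scalar_map A 2) \<in> \<D>"
    and "cone_choice F_Z4 \<D> K"
  shows "extension_class (arrow_category F_Z4) (Theta F_Z4 id_functor K)
             (Triangles0 F_Z4 id_functor K) Triangles0_proj (Theta_incl F_Z4)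
           \<notin> HH2_map (arrow_category F_Z4) (Theta F_Z4 id_functor K) (theta F_Z4 id_functor K)
               ` carrier (HH2 (arrow_category F_Z4) (Toda F_Z4 id_functor)) \<and>
         (\<nexists>(E :: ('e, 'f) category) p i T.
           singular_extension (arrow_category F_Z4) (Toda F_Z4 id_functor) E p i \<and>
           extension_morphism (Toda F_Z4 id_functor) (theta F_Z4 id_functor K) E p i
             (Triangles0 F_Z4 id_functor K) Triangles0_proj (Theta_incl F_Z4) T)"
proof -
  interpret untranslated_triangulated_category F_Z4 \<D>
    by (rule untranslated_triangulated_category.intro) (rule assms(1))
  \<comment> \<open>The scalar 2 acts as id + id, which places the given triangle in the scope of
    the abstract result.\<close>
  have two: "double_ide A = scalar_map A 2"
    unfolding double_ide_def by (rule ide_add_ide_eq_scalar_map[OF assms(2)])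
  have "A \<in> Ob F_Z4" "(A, A, A, double_ide A, double_ide A, double_ide A) \<in> \<D>"
    "double_ide A \<otimes>\<^bsub>Mor F_Z4 A A\<^esub> double_ide A = zero_mor F_Z4 A A"
    "double_ide A \<noteq> zero_mor F_Z4 A A"
    unfolding two using assms(3) free_rank1_Ob[OF assms(2)] scalar_map_2_add_self[OF assms(2)]
      scalar_map_2_neq_zero[OF assms(2)] by simp_all
  note h = assms(4) this
  show ?thesis
    using extension_class_notin_theta_image[OF h] no_extension_morphism_along_theta[OF h] by blast
qed

end
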